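(* Suppose $\rho$ is a constant function, $\rho\equiv\rho(0)>0$, let $\nu>0$, and let $\Gamma^{(\nu)}$ be the Stratonovich solution of $$d\theta(t,x,y)=\nu\,(\partial_x^2+\partial_y^2)\theta(t,x,y)\,dt+\sqrt{\rho(0)}\,\partial_y\theta(t,x,y)\circ dW_t\quad\text{on }(0,\infty)\times\mathbb{R}^2,\qquad\theta(0)=\delta_0\otimes\delta_0,$$ where $W=\{W_t\}_{t\ge0}$ is a standard Brownian motion. Choose and fix a real number $\delta>0$. Then, with probability one, $$\mathrm{Dim}_{\rm M}\left(\log\left\{t>e:\ \Gamma^{(\nu)}_t(0,0)<\frac1{t(\log t)^\delta}\right\}\right)=\left(1-\frac{2\delta\nu}{\rho(0)}\right)_+ .$$
   Context: In the constant-$\rho$ case the value of $\Gamma^{(\nu)}$ at the spatial origin is explicitly $$\Gamma^{(\nu)}_t(0,0)=p^{(\nu)}_t(0)\,p^{(\nu)}_t\left(\sqrt{\rho(0)}\,W_t\right)=\frac1{4\pi\nu t}\exp\left\{-\frac{\rho(0)W_t^2}{4\nu t}\right\}\qquad(t>0),$$ where $p^{(\nu)}_t(x)=(4\pi\nu t)^{-1/2}\exp(-x^2/(4\nu t))$; this is the (continuous) version used. For $A\subset(0,\infty)$, $\log A=\{\log t:t\in A\}$; $a_+=\max(a,0)$. Macroscopic Minkowski dimension: for $A\subset\mathbb{R}_+$ and integers $m\ge1$ let $\mathcal{C}_m(A)=\#\{j\in\{0,\ldots,m\}:[j,j+1]\cap A\ne\varnothing\}$, and $$\overline{\mathrm{Dim}}_{\rm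 M}(A)=\limsup_{m\to\infty}\frac{\log\mathcal{C}_m(A)}{\log m},\qquad\underline{\mathrm{Dim}}_{\rm M}(A)=\liminf_{m\to\infty}\frac{\log\mathcal{C}_m(A)}{\log m},$$ with the convention that the empty set has dimension $0$. When the two agree, the common value is denoted $\mathrm{Dim}_{\rm M}(A)$; a statement $\mathrm{Dim}_{\rm M}(A)=d$ includes the assertion that both equal $d$. *)

theory Defs
  imports "HOL-Probability.Probability"
begin

text \<open>
  For nonempty \<open>A \<subseteq> {0..}\<close> the number of unit cells is eventually positive, so the value
  \<open>ln 0 = 0\<close> does not affect the upper and lower macroscopic Minkowski dimensions.
\<close>

definition unit_cells :: "real set \<Rightarrow> nat \<Rightarrow> nat" where
  "unit_cells A m = card {j \<in> {0..m}. {real j .. real j + 1} \<inter> A \<noteq> {}}"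

definition upper_Dim_M :: "real set \<Rightarrow> ereal" where
  "upper_Dim_M A =
     (if A = {} then 0 else limsup (\<lambda>m. ereal (ln (real (unit_cells A m)) / ln (real m))))"

definition lower_Dim_M :: "real set \<Rightarrow> ereal" where
  "lower_Dim_M A =
     (if A = {} then 0 else liminf (\<lambda>m. ereal (ln (real (unit_cells A m)) / ln (real m))))"

definition has_Dim_M :: "real set \<Rightarrow> real \<Rightarrow> bool" where
  "has_Dim_M A d \<longleftrightarrow> upper_Dim_M A = ereal d \<and> lower_Dim_M A = ereal d"


text \<open>Brownian motion indexed by the nonnegative reals; \<open>W t\<close> is irrelevant for \<open>t < 0\<close>.\<close>

definition standard_brownian_motion :: "'a measure \<Rightarrow> (real \<Rightarrow> 'a \<Rightarrow> real) \<Rightarrow> bool" where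
  "standard_brownian_motion M W \<longleftrightarrow>
     prob_space M \<and>
     (\<forall>t\<ge>0. W t \<in> borel_measurable M) \<and>
     (AE \<omega> in M. W 0 \<omega> = 0) \<and>
     (AE \<omega> in M. continuous_on {0..} (\<lambda>t. W t \<omega>)) \<and>
     (\<forall>s t. 0 \<le> s \<and> s < t \<longrightarrow>
        distributed M lborel (\<lambda>\<omega>. W t \<omega> - W s \<omega>) (normal_density 0 (sqrt (t - s)))) \<and>
     (\<forall>(n::nat) t. 0 \<le> t 0 \<and> (\<forall>i<n. t i < t (Suc i)) \<longrightarrow>
        prob_space.indep_vars M (\<lambda>_. borel) (\<lambda>i \<omega>. W (t (Suc i)) \<omega> - W (t i) \<omega>) {..<n})"

definition past :: "'a measure \<Rightarrow> (real \<Rightarrow> 'a \<Rightarrow> real) \<Rightarrow> real \<Rightarrow> 'a measure" where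
  "past M W t =
     sigma (space M) {W s -` B \<inter> space M | s B. 0 \<le> s \<and> s \<le> t \<and> B \<in> sets borel}"


text \<open>
  Stratonovich integral of \<open>Y\<close> against \<open>W\<close> over \<open>[0, t]\<close>: the limit in probability
  of the trapezoidal sums, along every sequence of partitions
  \<open>0 = \<pi> n 0 \<le> \<dots> \<le> \<pi> n (N n) = t\<close> whose mesh tends to \<open>0\<close>.
\<close>

definition vanishing_partitions :: "real \<Rightarrow> (nat \<Rightarrow> nat) \<Rightarrow> (nat \<Rightarrow> nat \<Rightarrow> real) \<Rightarrow> bool" where
  "vanishing_partitions t N \<pi> \<longleftrightarrow>
     (\<forall>n. \<pi> n 0 = 0 \<and> \<pi> n (N n) = t \<and> (\<forall>i<N n. \<pi> n i \<le> \<pi> n (Suc i))) \<and>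
     (\<forall>\<epsilon>>0. \<forall>\<^sub>F n in sequentially. \<forall>i<N n. \<pi> n (Suc i) - \<pi> n i < \<epsilon>)"

definition has_stratonovich_integral ::
    "'a measure \<Rightarrow> (real \<Rightarrow> 'a \<Rightarrow> real) \<Rightarrow> (real \<Rightarrow> 'a \<Rightarrow> real) \<Rightarrow> real \<Rightarrow> ('a \<Rightarrow> real) \<Rightarrow> bool" where
  "has_stratonovich_integral M W Y t I \<longleftrightarrow>
     I \<in> borel_measurable M \<and>
     (\<forall>s\<in>{0..t}. Y s \<in> borel_measurable M) \<and>
     (\<forall>N \<pi>. vanishing_partitions t N \<pi> \<longrightarrow>
        (\<forall>\<epsilon>>0. (\<lambda>n. measure M {\<omega> \<in> space M.
            \<bar>(\<Sum>i<N n. (Y (\<pi> n i) \<omega> + Y (\<pi> n (Suc i)) \<omega>) / 2 *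
                       (W (\<pi> n (Suc i)) \<omega> - W (\<pi> n i) \<omega>)) - I \<omega>\<bar> > \<epsilon>})
          \<longlonglongrightarrow> 0))"


text \<open>Test functions on the plane, in curried form: smooth with bounded support.\<close>

definition pd_x :: "(real \<Rightarrow> real \<Rightarrow> real) \<Rightarrow> real \<Rightarrow> real \<Rightarrow> real" where
  "pd_x \<phi> = (\<lambda>x y. deriv (\<lambda>u. \<phi> u y) x)"

definition pd_y :: "(real \<Rightarrow> real \<Rightarrow> real) \<Rightarrow> real \<Rightarrow> real \<Rightarrow> real" where
  "pd_y \<phi> = (\<lambda>x y. deriv (\<lambda>v. \<phi> x v) y)"

definition laplacian :: "(real \<Rightarrow> real \<Rightarrow> real) \<Rightarrow> real \<Rightarrow> real \<Rightarrow> real" where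
  "laplacian \<phi> = (\<lambda>x y. pd_x (pd_x \<phi>) x y + pd_y (pd_y \<phi>) x y)"

text \<open>All iterated partial derivatives exist and are jointly continuous.\<close>

coinductive smooth_plane :: "(real \<Rightarrow> real \<Rightarrow> real) \<Rightarrow> bool" where
  "continuous_on UNIV (\<lambda>(x, y). \<phi> x y) \<Longrightarrow>
   (\<And>x y. (\<lambda>u. \<phi> u y) field_differentiable (at x)) \<Longrightarrow>
   (\<And>x y. (\<lambda>v. \<phi> x v) field_differentiable (at y)) \<Longrightarrow>
   smooth_plane (pd_x \<phi>) \<Longrightarrow> smooth_plane (pd_y \<phi>) \<Longrightarrow> smooth_plane \<phi>"

definition test_function :: "(real \<Rightarrow> real \<Rightarrow> real) \<Rightarrow> bool" where
  "test_function \<phi> \<longleftrightarrow> smooth_plane \<phi> \<and> bounded {(x, y). \<phi> x y \<noteq> 0}"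


text \<open>
  The pairing of the random field \<open>\<theta> t x y \<omega>\<close> at time \<open>t\<close> with a test function; at time \<open>0\<close>
  the field is the point mass at the origin.
\<close>

definition pairing ::
    "(real \<Rightarrow> real \<Rightarrow> real \<Rightarrow> 'a \<Rightarrow> real) \<Rightarrow> (real \<Rightarrow> real \<Rightarrow> real) \<Rightarrow> real \<Rightarrow> 'a \<Rightarrow> real" where
  "pairing \<theta> \<phi> t \<omega> =
     (if t = 0 then \<phi> 0 0 else (LINT (x, y)|lborel. \<theta> t x y \<omega> * \<phi> x y))"

text \<open>
  Continuous adapted random field solutions, in the weak sense, of
  \<open>d\<theta> = \<nu> (\<partial>\<^sub>x\<^sup>2 + \<partial>\<^sub>y\<^sup>2) \<theta> dt + \<sigma> \<partial>\<^sub>y\<theta> \<circ> dW\<close> with \<open>\<theta>(0) = \<delta>\<^sub>0 \<otimes> \<delta>\<^sub>0\<close>.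
  The minus sign is the one of the integration by parts
  \<open>\<langle>\<partial>\<^sub>y\<theta>, \<phi>\<rangle> = - \<langle>\<theta>, \<partial>\<^sub>y\<phi>\<rangle>\<close>.
\<close>

definition stratonovich_solution ::
    "'a measure \<Rightarrow> (real \<Rightarrow> 'a \<Rightarrow> real) \<Rightarrow> real \<Rightarrow> real \<Rightarrow>
     (real \<Rightarrow> real \<Rightarrow> real \<Rightarrow> 'a \<Rightarrow> real) \<Rightarrow> bool" where
  "stratonovich_solution M W \<nu> \<sigma> \<theta> \<longleftrightarrow>
     (\<forall>t>0. \<forall>x y. \<theta> t x y \<in> borel_measurable M \<and>
        (\<exists>g \<in> borel_measurable (past M W t). AE \<omega> in M. \<theta> t x y \<omega> = g \<omega>)) \<and>
     (AE \<omega> in M. continuous_on ({0<..} \<times> UNIV) (\<lambda>(t, x, y). \<theta> t x y \<omega>)) \<and>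
     (\<forall>\<phi>. test_function \<phi> \<longrightarrow>
        (AE \<omega> in M. ((\<lambda>t. pairing \<theta> \<phi> t \<omega>) \<longlongrightarrow> \<phi> 0 0) (at_right 0)) \<and>
        (\<forall>t>0.
           (AE \<omega> in M. set_integrable lborel {0..t} (\<lambda>s. pairing \<theta> (laplacian \<phi>) s \<omega>)) \<and>
           (\<exists>I. has_stratonovich_integral M W (pairing \<theta> (pd_y \<phi>)) t I \<and>
              (AE \<omega> in M. pairing \<theta> \<phi> t \<omega> =
                 \<phi> 0 0 + \<nu> * (LBINT s:{0..t}. pairing \<theta> (laplacian \<phi>) s \<omega>) - \<sigma> * I \<omega>))))"

definition heat_kernel :: "real \<Rightarrow> real \<Rightarrow> real \<Rightarrow> real" where
  "heat_kernel \<nu> t x = (4 * pi * \<nu> * t) powr (- 1 / 2) * exp (- x\<^sup>2 / (4 * \<nu> * t))"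

end

theory Submission
  imports Defs "HOL-Real_Asymp.Real_Asymp"
begin

text \<open>
  Put \<open>s = ln t\<close>. By the explicit formula, \<open>s\<close> belongs to the set iff \<open>s > 1\<close> and
  \<open>U\<^sub>s\<^sup>2 > 2 \<kappa> ln s - c\<close>, where \<open>U\<^sub>s = W (e\<^sup>s) / e\<^bsup>s/2\<^esup>\<close> is a stationary
  Gaussian process with unit variance, \<open>\<kappa> = 2 \<delta> \<nu> / \<rho> 0\<close> and
  \<open>c = (4 \<nu> / \<rho> 0) ln (4 \<pi> \<nu>)\<close>. This event has probability about \<open>s\<^bsup>-\<kappa>\<^esup>\<close>.

  Upper bound: split \<open>[j, j + 1]\<close> into \<open>n\<close> equal pieces and apply the maximal inequality for
  Brownian motion on each; the cell is hit with probability at most a constant times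
  \<open>j\<^bsup>-\<kappa> exp (-1/n)\<^esup>\<close>. Hence the sum of \<open>j\<^bsup>-\<gamma>\<^esup>\<close> over the hit cells has finite expectation for
  every \<open>\<gamma> > (1 - \<kappa>)\<^sub>+\<close> when \<open>n\<close> is large, which bounds the number of hit cells up to \<open>m\<close> by
  a random multiple of \<open>m\<^bsup>\<gamma>\<^esup>\<close>.

  Lower bound for \<open>\<kappa> < 1\<close>: write \<open>U\<^bsub>(i+1)b\<^esub> = sqrt (1 - e\<^bsup>-b\<^esup>) V\<^sub>i + e\<^bsup>-b/2\<^esup> U\<^bsub>ib\<^esub>\<close> with independent
  standard normal \<open>V\<^sub>i\<close>. The second summand is at most \<open>2 e\<^bsup>-b/2\<^esup> sqrt (ln ((i+1) b))\<close> eventually, so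
  for large \<open>b\<close> it is enough to count the large \<open>V\<^sub>i\<close>, which is done by an exponential moment
  bound and the Borel-Cantelli lemma.
\<close>

subsection \<open>Gaussian tails and a maximal inequality\<close>

context prob_space
begin

lemma distributed_normal_uminus:
  assumes "distributed M lborel X (normal_density 0 \<sigma>)" and "\<sigma> > 0"
  shows "distributed M lborel (\<lambda>\<omega>. - X \<omega>) (normal_density 0 \<sigma>)"
  using normal_density_affine[OF assms, of "- 1" 0] by simp

text \<open>The two closed half lines are equally likely by symmetry and together cover the space.
  This supplies the median hypothesis \<open>med\<close> of
  \<open>Levy_maximal_inequality\<close>.\<close>

lemma normal_prob_ge_0:
  assumes X: "distributed M lborel X (normal_density 0 \<sigma>)" and "\<sigma> > 0"
  shows "prob {\<omega> \<in> space M. X \<omega> \<ge> 0} \<ge> 1 / 2"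
proof -
  have [measurable]: "X \<in> borel_measurable M"
    using distributed_measurable[OF X] by simp
  note Y = distributed_normal_uminus[OF X \<open>\<sigma> > 0\<close>]
  have "emeasure M (X -` {0..} \<inter> space M) = emeasure M ((\<lambda>\<omega>. - X \<omega>) -` {0..} \<inter> space M)"
    using distributed_emeasure[OF X, of "{0..}"] distributed_emeasure[OF Y, of "{0..}"] by simp
  moreover have "X -` {0..} \<inter> space M = {\<omega> \<in> space M. X \<omega> \<ge> 0}"
    "(\<lambda>\<omega>. - X \<omega>) -` {0..} \<inter> space M = {\<omega> \<in> space M. X \<omega> \<le> 0}"
    by auto
  ultimately have eq: "prob {\<omega> \<in> space M. X \<omega> \<ge> 0} = prob {\<omega> \<in> space M. X \<omega> \<le> 0}"
    by (simp add: measure_def)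
  have "1 = prob ({\<omega> \<in> space M. X \<omega> \<ge> 0} \<union> {\<omega> \<in> space M. X \<omega> \<le> 0})"
    by (subst prob_space[symmetric]) (auto intro!: arg_cong[where f = prob])
  also have "\<dots> \<le> prob {\<omega> \<in> space M. X \<omega> \<ge> 0} + prob {\<omega> \<in> space M. X \<omega> \<le> 0}"
    by (intro measure_Un_le) auto
  finally show ?thesis using eq by simp
qed

text \<open>For \<open>u \<ge> x \<ge> 0\<close> one has
  \<open>x\<^sup>2 + (u - x)\<^sup>2 \<le> u\<^sup>2\<close>, so beyond \<open>x\<close> the density
  lies below the claimed bound times the normal density centred at \<open>x\<close>, which has total
  mass 1.\<close>

lemma normal_upper_tail:
  assumes X: "distributed M lborel X (normal_density 0 \<sigma>)" and "\<sigma> > 0" and "x \<ge> 0"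
  shows "prob {\<omega> \<in> space M. X \<omega> \<ge> x} \<le> exp (- x\<^sup>2 / (2 * \<sigma>\<^sup>2))"
proof -
  have bound: "normal_density 0 \<sigma> u * indicator {x..} u \<le> exp (- x\<^sup>2 / (2 * \<sigma>\<^sup>2)) * normal_density x \<sigma> u" for u
  proof (cases "u \<ge> x")
    case True
    have "x * x \<le> u * x"
      using True \<open>x \<ge> 0\<close> by (rule mult_right_mono)
    then have "x\<^sup>2 + (u - x)\<^sup>2 \<le> u\<^sup>2"
      by (simp add: power2_eq_square algebra_simps)
    then have "- u\<^sup>2 / (2 * \<sigma>\<^sup>2) \<le> - x\<^sup>2 / (2 * \<sigma>\<^sup>2) + - (u - x)\<^sup>2 / (2 * \<sigma>\<^sup>2)"
      using \<open>\<sigma> > 0\<close> by (simp add: divide_simps)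
    then have "exp (- u\<^sup>2 / (2 * \<sigma>\<^sup>2)) \<le> exp (- x\<^sup>2 / (2 * \<sigma>\<^sup>2)) * exp (- (u - x)\<^sup>2 / (2 * \<sigma>\<^sup>2))"
      by (simp flip: exp_add)
    then show ?thesis
      using True \<open>\<sigma> > 0\<close> by (simp add: normal_density_def divide_right_mono)
  qed (simp add: indicator_def)
  have "emeasure M (X -` {x..} \<inter> space M) = (\<integral>\<^sup>+u. ennreal (normal_density 0 \<sigma> u) * indicator {x..} u \<partial>lborel)"
    by (rule distributed_emeasure[OF X]) simp
  also have "\<dots> = (\<integral>\<^sup>+u. ennreal (normal_density 0 \<sigma> u * indicator {x..} u) \<partial>lborel)"
    by (intro nn_integral_cong) (simp add: indicator_def)
  also have "\<dots> \<le> (\<integral>\<^sup>+u. ennreal (exp (- x\<^sup>2 / (2 * \<sigma>\<^sup>2)) * normal_density x \<sigma> u) \<partial>lborel)"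
    by (intro nn_integral_mono ennreal_leI bound)
  also have "\<dots> = ennreal (exp (- x\<^sup>2 / (2 * \<sigma>\<^sup>2)))"
    using \<open>\<sigma> > 0\<close> by (subst nn_integral_eq_integral) (auto)
  finally have "emeasure M (X -` {x..} \<inter> space M) \<le> ennreal (exp (- x\<^sup>2 / (2 * \<sigma>\<^sup>2)))" .
  moreover have "X -` {x..} \<inter> space M = {\<omega> \<in> space M. X \<omega> \<ge> x}"
    by auto
  ultimately show ?thesis
    by (simp add: emeasure_eq_measure)
qed

lemma normal_abs_tail:
  assumes X: "distributed M lborel X (normal_density 0 \<sigma>)" and "\<sigma> > 0" and "x \<ge> 0"
  shows "prob {\<omega> \<in> space M. \<bar>X \<omega>\<bar> \<ge> x} \<le> 2 * exp (- x\<^sup>2 / (2 * \<sigma>\<^sup>2))"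
proof -
  have [measurable]: "X \<in> borel_measurable M"
    using distributed_measurable[OF X] by simp
  note Y = distributed_normal_uminus[OF X \<open>\<sigma> > 0\<close>]
  have "prob {\<omega> \<in> space M. \<bar>X \<omega>\<bar> \<ge> x}
      \<le> prob ({\<omega> \<in> space M. X \<omega> \<ge> x} \<union> {\<omega> \<in> space M. - X \<omega> \<ge> x})"
    by (intro finite_measure_mono) auto
  also have "\<dots> \<le> prob {\<omega> \<in> space M. X \<omega> \<ge> x} + prob {\<omega> \<in> space M. - X \<omega> \<ge> x}"
    by (intro measure_Un_le) auto
  also have "\<dots> \<le> 2 * exp (- x\<^sup>2 / (2 * \<sigma>\<^sup>2))"
    using normal_upper_tail[OF X \<open>\<sigma> > 0\<close> \<open>x \<ge> 0\<close>] normal_upper_tail[OF Y \<open>\<sigma> > 0\<close> \<open>x \<ge> 0\<close>] by linarith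
  finally show ?thesis .
qed

text \<open>Only the window of length \<open>\<sigma>\<close> to the right of
  \<open>\<sigma> * x\<close> is integrated; there the density is at least its value at the right
  end, whence \<open>x + 1\<close> instead of \<open>x\<close>.\<close>

lemma normal_lower_tail:
  assumes X: "distributed M lborel X (normal_density 0 \<sigma>)" and "\<sigma> > 0" and "x \<ge> 0"
  shows "prob {\<omega> \<in> space M. X \<omega> > \<sigma> * x} \<ge> exp (- (x + 1)\<^sup>2 / 2) / sqrt (2 * pi)"
proof -
  let ?c = "exp (- (x + 1)\<^sup>2 / 2) / sqrt (2 * pi) / \<sigma>"
  have bound: "?c * indicator {\<sigma> * x<..\<sigma> * x + \<sigma>} u \<le> normal_density 0 \<sigma> u * indicator {\<sigma> * x<..} u" for u
  proof (cases "u \<in> {\<sigma> * x<..\<sigma> * x + \<sigma>}")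
    case True
    have "u\<^sup>2 \<le> (\<sigma> * x + \<sigma>)\<^sup>2"
      using True assms by (intro power_mono) (auto intro: order_trans[of 0 "\<sigma> * x"])
    also have "\<dots> = (x + 1)\<^sup>2 * \<sigma>\<^sup>2"
      by (simp add: power2_eq_square algebra_simps)
    finally have "- (x + 1)\<^sup>2 / 2 \<le> - u\<^sup>2 / (2 * \<sigma>\<^sup>2)"
      using \<open>\<sigma> > 0\<close> by (simp add: divide_simps)
    moreover have "sqrt (2 * pi * \<sigma>\<^sup>2) = sqrt (2 * pi) * \<sigma>"
      using \<open>\<sigma> > 0\<close> by (simp add: real_sqrt_mult)
    ultimately show ?thesis
      using True \<open>\<sigma> > 0\<close> by (simp add: normal_density_def divide_right_mono)
  qed (simp add: indicator_def)
  have "ennreal (?c * \<sigma>) = (\<integral>\<^sup>+u. ennreal ?c * indicator {\<sigma> * x<..\<sigma> * x + \<sigma>} u \<partial>lborel)"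
    using \<open>\<sigma> > 0\<close> by (subst nn_integral_cmult_indicator) (auto simp: ennreal_mult[symmetric])
  also have "\<dots> = (\<integral>\<^sup>+u. ennreal (?c * indicator {\<sigma> * x<..\<sigma> * x + \<sigma>} u) \<partial>lborel)"
    by (intro nn_integral_cong) (simp add: indicator_def)
  also have "\<dots> \<le> (\<integral>\<^sup>+u. ennreal (normal_density 0 \<sigma> u * indicator {\<sigma> * x<..} u) \<partial>lborel)"
    by (intro nn_integral_mono ennreal_leI bound)
  also have "\<dots> = (\<integral>\<^sup>+u. ennreal (normal_density 0 \<sigma> u) * indicator {\<sigma> * x<..} u \<partial>lborel)"
    by (intro nn_integral_cong) (simp add: indicator_def)
  also have "\<dots> = emeasure M (X -` {\<sigma> * x<..} \<inter> space M)"
    by (rule distributed_emeasure[OF X, symmetric]) simp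
  finally have "ennreal (?c * \<sigma>) \<le> emeasure M (X -` {\<sigma> * x<..} \<inter> space M)" .
  moreover have "X -` {\<sigma> * x<..} \<inter> space M = {\<omega> \<in> space M. X \<omega> > \<sigma> * x}"
    by auto
  ultimately show ?thesis
    using \<open>\<sigma> > 0\<close> by (simp add: emeasure_eq_measure)
qed

text \<open>Decompose at the first \<open>k\<close> with partial sum above \<open>l\<close>: independently of the past, the
  remaining increments sum to a nonnegative number with probability at least \<open>1/2\<close>.\<close>

lemma Levy_maximal_inequality:
  fixes X :: "nat \<Rightarrow> 'a \<Rightarrow> real"
  assumes ind: "indep_vars (\<lambda>_. borel) X {..<n}"
    and med: "\<And>k. k \<le> n \<Longrightarrow> prob {\<omega> \<in> space M. (\<Sum>i=k..<n. X i \<omega>) \<ge> 0} \<ge> 1 / 2"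
  shows "prob {\<omega> \<in> space M. \<exists>k\<le>n. (\<Sum>i<k. X i \<omega>) > l}
    \<le> 2 * prob {\<omega> \<in> space M. (\<Sum>i<n. X i \<omega>) > l}"
proof -
  have [measurable]: "i < n \<Longrightarrow> X i \<in> borel_measurable M" for i
    using ind by (auto simp: indep_vars_def)
  define S where "S k \<omega> = (\<Sum>i<k. X i \<omega>)" for k \<omega>
  have S[measurable]: "S k \<in> borel_measurable M" if "k \<le> n" for k
    unfolding S_def using that by (intro borel_measurable_sum) auto
  define A where "A k = {\<omega> \<in> space M. S k \<omega> > l \<and> (\<forall>i<k. S i \<omega> \<le> l)}" for k
  define B where "B k = {\<omega> \<in> space M. (\<Sum>i=k..<n. X i \<omega>) \<ge> 0}" for k
  have A_meas: "A k \<in> sets M" if "k \<le> n" for k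
  proof -
    have "A k = {\<omega> \<in> space M. S k \<omega> > l \<and> (\<forall>i\<in>{..<k}. S i \<omega> \<le> l)}"
      by (auto simp: A_def)
    also have "\<dots> \<in> sets M"
      using that by (intro sets.sets_Collect_conj sets.sets_Collect_finite_All) auto
    finally show ?thesis .
  qed
  have B_meas: "B k \<in> sets M" if "k \<le> n" for k
    unfolding B_def by (intro borel_measurable_le borel_measurable_sum) auto
  have AB: "prob (A k \<inter> B k) = prob (A k) * prob (B k)" if "k \<le> n" for k
  proof -
    let ?P1 = "PiM {..<k} (\<lambda>_. borel :: real measure)" and ?P2 = "PiM {k..<n} (\<lambda>_. borel :: real measure)"
    let ?A = "{f \<in> space ?P1. (\<Sum>i<k. f i) > l \<and> (\<forall>m\<in>{..<k}. (\<Sum>i<m. f i) \<le> l)}"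
    let ?B = "{f \<in> space ?P2. (\<Sum>i=k..<n. f i) \<ge> 0}"
    \<comment> \<open>First passage at \<open>k\<close> depends on the increments before
      \<open>k\<close> only, and \<open>B k\<close> on those from \<open>k\<close> on; independence
      of the two blocks gives the product formula.\<close>
    have "indep_var ?P1 (\<lambda>\<omega>. restrict (\<lambda>i. X i \<omega>) {..<k}) ?P2 (\<lambda>\<omega>. restrict (\<lambda>i. X i \<omega>) {k..<n})"
      using that by (intro indep_var_restrict[OF ind]) auto
    moreover have "?A \<in> sets ?P1"
    proof -
      have [measurable]: "(\<lambda>f. \<Sum>i<m. f i) \<in> borel_measurable ?P1" if "m \<le> k" for m
        using that by (intro borel_measurable_sum measurable_component_singleton) auto
      show ?thesis
        by (intro sets.sets_Collect_conj sets.sets_Collect_finite_All) auto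
    qed
    moreover have "?B \<in> sets ?P2"
      by measurable
    ultimately have "prob ((\<lambda>\<omega>. (restrict (\<lambda>i. X i \<omega>) {..<k}, restrict (\<lambda>i. X i \<omega>) {k..<n})) -` (?A \<times> ?B) \<inter> space M)
      = prob ((\<lambda>\<omega>. restrict (\<lambda>i. X i \<omega>) {..<k}) -` ?A \<inter> space M) * prob ((\<lambda>\<omega>. restrict (\<lambda>i. X i \<omega>) {k..<n}) -` ?B \<inter> space M)"
      by (rule indep_varD)
    moreover have "(\<lambda>\<omega>. restrict (\<lambda>i. X i \<omega>) {..<k}) -` ?A \<inter> space M = A k"
      by (auto simp: A_def S_def space_PiM)
    moreover have "(\<lambda>\<omega>. restrict (\<lambda>i. X i \<omega>) {k..<n}) -` ?B \<inter> space M = B k"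
      by (auto simp: B_def space_PiM)
    moreover have "(\<lambda>\<omega>. (restrict (\<lambda>i. X i \<omega>) {..<k}, restrict (\<lambda>i. X i \<omega>) {k..<n})) -` (?A \<times> ?B) \<inter> space M
      = ((\<lambda>\<omega>. restrict (\<lambda>i. X i \<omega>) {..<k}) -` ?A \<inter> space M) \<inter> ((\<lambda>\<omega>. restrict (\<lambda>i. X i \<omega>) {k..<n}) -` ?B \<inter> space M)"
      by auto
    ultimately show ?thesis by simp
  qed
  have disj: "disjoint_family_on A {..n}"
    unfolding disjoint_family_on_def
  proof (intro ballI impI)
    fix i j :: nat assume "i \<noteq> j"
    moreover have *: "A i \<inter> A j = {}" if "i < j" for i j
      using that by (fastforce simp: A_def)
    ultimately show "A i \<inter> A j = {}"
      using *[of i j] *[of j i] by (auto simp: neq_iff)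
  qed
  then have disjB: "disjoint_family_on (\<lambda>k. A k \<inter> B k) {..n}"
    by (auto simp: disjoint_family_on_def)
  have union: "{\<omega> \<in> space M. \<exists>k\<le>n. S k \<omega> > l} = (\<Union>k\<le>n. A k)"
  proof (intro equalityI subsetI)
    fix \<omega> assume "\<omega> \<in> {\<omega> \<in> space M. \<exists>k\<le>n. S k \<omega> > l}"
    then obtain k where k: "\<omega> \<in> space M" "k \<le> n" "S k \<omega> > l" by auto
    define m where "m = (LEAST k. S k \<omega> > l)"
    have "S m \<omega> > l" unfolding m_def using k(3) by (rule LeastI)
    moreover have "m \<le> n" unfolding m_def using k by (auto intro: order_trans[OF Least_le])
    moreover have "S i \<omega> \<le> l" if "i < m" for i
      using not_less_Least that unfolding m_def by (metis linorder_not_less)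
    ultimately show "\<omega> \<in> (\<Union>k\<le>n. A k)" using k(1) by (auto simp: A_def)
  qed (auto simp: A_def)
  have "prob (\<Union>k\<le>n. A k) = (\<Sum>k\<le>n. prob (A k))"
    using A_meas disj by (intro finite_measure_finite_Union) auto
  also have "\<dots> \<le> (\<Sum>k\<le>n. 2 * prob (A k \<inter> B k))"
  proof (rule sum_mono)
    fix k assume "k \<in> {..n}"
    then have "prob (A k) * (1 / 2) \<le> prob (A k) * prob (B k)"
      using med[of k] by (intro mult_left_mono) (auto simp: B_def)
    then show "prob (A k) \<le> 2 * prob (A k \<inter> B k)"
      using AB[of k] \<open>k \<in> {..n}\<close> by simp
  qed
  also have "\<dots> = 2 * prob (\<Union>k\<le>n. A k \<inter> B k)"
    unfolding sum_distrib_left[symmetric] using A_meas B_meas disjB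
    by (subst finite_measure_finite_Union) auto
  also have "\<dots> \<le> 2 * prob {\<omega> \<in> space M. S n \<omega> > l}"
  proof -
    \<comment> \<open>The partial sum already exceeds \<open>l\<close> at \<open>k\<close>, and the
      remaining increments do not lower it.\<close>
    have "A k \<inter> B k \<subseteq> {\<omega> \<in> space M. S n \<omega> > l}" if "k \<le> n" for k
    proof -
      have "S n \<omega> = S k \<omega> + (\<Sum>i=k..<n. X i \<omega>)" for \<omega>
        unfolding S_def using that by (simp add: sum.atLeastLessThan_concat flip: atLeast0LessThan)
      then show ?thesis by (auto simp: A_def B_def)
    qed
    then show ?thesis by (intro mult_left_mono finite_measure_mono) (auto intro: S)
  qed
  finally show ?thesis
    unfolding union[symmetric] by (simp add: S_def)
qed

end

subsection \<open>Counting occupied cells\<close>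

text \<open>Multiplicative constants vanish after division by \<open>ln m\<close>. For
  \<open>d = 0\<close> the lower hypothesis is vacuous, in accordance with the quotients being
  nonnegative anyway.\<close>

lemma has_Dim_M_I:
  assumes "d \<ge> 0"
    and upper: "\<And>\<epsilon>. \<epsilon> > 0 \<Longrightarrow> \<exists>K. \<forall>m\<ge>1. real (unit_cells A m) \<le> K * real m powr (d + \<epsilon>)"
    and lower: "\<And>\<epsilon>. 0 < \<epsilon> \<Longrightarrow> \<epsilon> < d \<Longrightarrow>
      \<exists>c>0. \<forall>\<^sub>F m in sequentially. c * real m powr (d - \<epsilon>) \<le> real (unit_cells A m)"
  shows "has_Dim_M A d"
proof -
  let ?f = "\<lambda>m. ln (real (unit_cells A m)) / ln (real m)"
  have small: "\<forall>\<^sub>F m in sequentially. \<bar>x / ln (real m)\<bar> < \<epsilon>" if "\<epsilon> > 0" for x \<epsilon> :: real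
  proof -
    have "(\<lambda>m. x / ln (real m)) \<longlonglongrightarrow> 0"
      by (intro tendsto_divide_0[OF tendsto_const] filterlim_at_top_imp_at_infinity
          filterlim_compose[OF ln_at_top filterlim_real_sequentially])
    from tendstoD[OF this that] show ?thesis by simp
  qed
  have "limsup (\<lambda>m. ereal (?f m)) \<le> ereal d"
  proof (rule ereal_le_epsilon2)
    fix \<epsilon> :: real assume "\<epsilon> > 0"
    then obtain K where K: "\<forall>m\<ge>1. real (unit_cells A m) \<le> K * real m powr (d + \<epsilon> / 2)"
      using upper[of "\<epsilon> / 2"] by auto
    have "\<forall>\<^sub>F m in sequentially. \<bar>ln (max K 1) / ln (real m)\<bar> < \<epsilon> / 2"
      by (rule small) (use \<open>\<epsilon> > 0\<close> in auto)
    then have "\<forall>\<^sub>F m in sequentially. ?f m \<le> d + \<epsilon>"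
      using eventually_ge_at_top[of 2]
    proof eventually_elim
      case (elim m)
      have lnm: "ln (real m) > 0" using elim by simp
      \<comment> \<open>If no cell is occupied, the quotient is 0 because \<open>ln 0 = 0\<close>,
        and \<open>d \<ge> 0\<close> suffices.\<close>
      show ?case
      proof (cases "unit_cells A m = 0")
        case False
        have "real (unit_cells A m) \<le> K * real m powr (d + \<epsilon> / 2)"
          using K elim by simp
        also have "\<dots> \<le> max K 1 * real m powr (d + \<epsilon> / 2)"
          by (intro mult_right_mono) auto
        finally have "ln (real (unit_cells A m)) \<le> ln (max K 1 * real m powr (d + \<epsilon> / 2))"
          using False by (subst ln_le_cancel_iff) (use elim in auto)
        also have "\<dots> = ln (max K 1) + (d + \<epsilon> / 2) * ln (real m)"
          using elim by (subst ln_mult) (auto simp: ln_powr)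
        finally have "?f m \<le> ln (max K 1) / ln (real m) + (d + \<epsilon> / 2)"
          using lnm by (simp add: field_simps)
        then show ?thesis using elim(1) by linarith
      qed (use \<open>d \<ge> 0\<close> \<open>\<epsilon> > 0\<close> in simp)
    qed
    then show "limsup (\<lambda>m. ereal (?f m)) \<le> ereal d + ereal \<epsilon>"
      by (intro Limsup_bounded) (simp add: eventually_mono)
  qed
  moreover have "ereal d \<le> liminf (\<lambda>m. ereal (?f m))"
  proof (cases "d = 0")
    case True
    \<comment> \<open>The values \<open>ln 0 = 0\<close> and division by zero equal to 0 cover a
      vanishing count and \<open>m \<le> 1\<close>.\<close>
    have "0 \<le> ?f m" for m
      by (cases "unit_cells A m = 0"; cases "m = 0") auto
    then show ?thesis
      using True by (intro Liminf_bounded) simp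
  next
    case False
    show ?thesis
    proof (rule ereal_le_epsilon2)
      fix \<epsilon>' :: real assume "\<epsilon>' > 0"
      \<comment> \<open>The cap at \<open>d\<close> makes \<open>\<epsilon> / 2 < d\<close>, as the
        lower hypothesis requires.\<close>
      define \<epsilon> where "\<epsilon> = min \<epsilon>' d"
      have "\<epsilon> > 0" "\<epsilon> \<le> d" "\<epsilon> \<le> \<epsilon>'"
        using \<open>\<epsilon>' > 0\<close> \<open>d \<ge> 0\<close> False by (auto simp: \<epsilon>_def)
      then obtain c where "c > 0"
        and c: "\<forall>\<^sub>F m in sequentially. c * real m powr (d - \<epsilon> / 2) \<le> real (unit_cells A m)"
        using lower[of "\<epsilon> / 2"] by auto
      have "\<forall>\<^sub>F m in sequentially. \<bar>ln c / ln (real m)\<bar> < \<epsilon> / 2"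
        by (rule small) (use \<open>\<epsilon> > 0\<close> in auto)
      then have "\<forall>\<^sub>F m in sequentially. d - \<epsilon> \<le> ?f m"
        using eventually_ge_at_top[of 2] c
      proof eventually_elim
        case (elim m)
        have lnm: "ln (real m) > 0" using elim by simp
        have "ln c + (d - \<epsilon> / 2) * ln (real m) = ln (c * real m powr (d - \<epsilon> / 2))"
          using elim \<open>c > 0\<close> by (subst ln_mult) (auto simp: ln_powr)
        also have "\<dots> \<le> ln (real (unit_cells A m))"
        proof (rule ln_mono)
          show "0 < c * real m powr (d - \<epsilon> / 2)" using \<open>c > 0\<close> elim by simp
        qed (use elim in simp)
        finally have "(ln c + (d - \<epsilon> / 2) * ln (real m)) / ln (real m) \<le> ?f m"
          using lnm by (intro divide_right_mono) auto
        then have "ln c / ln (real m) + (d - \<epsilon> / 2) \<le> ?f m"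
          using lnm by (simp add: add_divide_distrib)
        then show ?case using elim(1) by linarith
      qed
      then have "ereal (d - \<epsilon>) \<le> liminf (\<lambda>m. ereal (?f m))"
        by (intro Liminf_bounded) (simp add: eventually_mono)
      then have "ereal (d - \<epsilon>) + ereal \<epsilon> \<le> liminf (\<lambda>m. ereal (?f m)) + ereal \<epsilon>'"
        using \<open>\<epsilon> \<le> \<epsilon>'\<close> by (intro add_mono) auto
      then show "ereal d \<le> liminf (\<lambda>m. ereal (?f m)) + ereal \<epsilon>'"
        by simp
    qed
  qed
  moreover have "liminf (\<lambda>m. ereal (?f m)) \<le> limsup (\<lambda>m. ereal (?f m))"
    by (rule Liminf_le_Limsup) simp
  \<comment> \<open>The empty set has dimension 0 by convention; if \<open>d\<close> were positive,
    the lower hypothesis would force an occupied cell.\<close>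
  moreover have "d = 0" if "A = {}"
  proof (rule ccontr)
    assume "d \<noteq> 0"
    then obtain c where "c > 0"
      and "\<forall>\<^sub>F m in sequentially. c * real m powr (d - d / 2) \<le> real (unit_cells A m)"
      using lower[of "d / 2"] \<open>d \<ge> 0\<close> by auto
    then have "\<forall>\<^sub>F m in sequentially. m > 0 \<and> c * real m powr (d - d / 2) \<le> real (unit_cells A m)"
      by (intro eventually_conj eventually_gt_at_top)
    then obtain m where "m > 0" "c * real m powr (d - d / 2) \<le> real (unit_cells A m)"
      using eventually_happens'[OF sequentially_bot] by blast
    moreover from this have "0 < c * real m powr (d - d / 2)"
      using \<open>c > 0\<close> by simp
    ultimately show False
      using that by (simp add: unit_cells_def)
  qed
  ultimately show ?thesis
    unfolding has_Dim_M_def upper_Dim_M_def lower_Dim_M_def by (auto simp: zero_ereal_def intro!: antisym)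
qed

context prob_space
begin

text \<open>The sum of \<open>j powr (- \<gamma>)\<close> over the \<open>j\<close> for which \<open>H j\<close> occurs has finite expectation.
  The term \<open>j = 0\<close> vanishes because \<open>0 powr x = 0\<close>.\<close>

lemma AE_count_events_le_powr:
  assumes H: "\<And>j. H j \<in> events"
    and prob: "\<And>j. j \<ge> 1 \<Longrightarrow> prob (H j) \<le> K * real j powr (- a)"
    and "\<gamma> \<ge> 0" "a + \<gamma> > 1"
  shows "AE \<omega> in M. \<exists>S\<ge>0. \<forall>m. real (card {j \<in> {1..m}. \<omega> \<in> H j}) \<le> S * real m powr \<gamma>"
proof -
  let ?w = "\<lambda>j. real j powr (- \<gamma>)"
  let ?F = "\<lambda>\<omega>. \<Sum>j. ennreal (?w j) * indicator (H j) \<omega>"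
  have "(\<integral>\<^sup>+\<omega>. ?F \<omega> \<partial>M) = (\<Sum>j. \<integral>\<^sup>+\<omega>. ennreal (?w j) * indicator (H j) \<omega> \<partial>M)"
    using H by (intro nn_integral_suminf) auto
  also have "\<dots> = (\<Sum>j. ennreal (?w j * prob (H j)))"
    using H by (intro suminf_cong) (simp add: nn_integral_cmult_indicator emeasure_eq_measure ennreal_mult)
  also have "\<dots> \<noteq> \<top>"
  proof -
    \<comment> \<open>The weight \<open>j powr (- \<gamma>)\<close> raises the decay of the
      probabilities to the summable exponent \<open>a + \<gamma> > 1\<close>.\<close>
    have "summable (\<lambda>j. K * real j powr (- (a + \<gamma>)))"
      using assms by (intro summable_mult) (simp add: summable_real_powr_iff)
    then have "summable (\<lambda>j. ?w j * prob (H j))"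
    proof (rule summable_comparison_test')
      fix j :: nat assume "j \<ge> 1"
      have "?w j * prob (H j) \<le> ?w j * (K * real j powr (- a))"
        using prob[OF \<open>j \<ge> 1\<close>] by (intro mult_left_mono) auto
      also have "\<dots> = K * real j powr (- (a + \<gamma>))"
        by (simp add: powr_add[symmetric] algebra_simps)
      finally show "norm (?w j * prob (H j)) \<le> K * real j powr (- (a + \<gamma>))"
        by simp
    qed
    then show ?thesis
      by (subst suminf_ennreal2) auto
  qed
  finally have "AE \<omega> in M. ?F \<omega> \<noteq> \<infinity>"
    using H by (intro nn_integral_noteq_infinite borel_measurable_suminf) auto
  then show ?thesis
  proof eventually_elim
    case (elim \<omega>)
    define S where "S = enn2real (?F \<omega>)"
    have S: "ennreal S = ?F \<omega>"
      using elim by (simp add: S_def less_top)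
    show ?case
    proof (intro exI[of _ S] conjI allI)
      show "S \<ge> 0" by (simp add: S_def)
      fix m :: nat
      have "ennreal (\<Sum>j=1..m. ?w j * indicator (H j) \<omega>) = (\<Sum>j=1..m. ennreal (?w j) * indicator (H j) \<omega>)"
        by (subst sum_ennreal[symmetric]) (auto simp: indicator_def intro!: sum.cong)
      also have "\<dots> \<le> ?F \<omega>"
        by (intro sum_le_suminf) auto
      finally have le: "(\<Sum>j=1..m. ?w j * indicator (H j) \<omega>) \<le> S"
        using \<open>S \<ge> 0\<close> by (simp flip: S)
      have "real (card {j \<in> {1..m}. \<omega> \<in> H j}) = (\<Sum>j=1..m. indicator (H j) \<omega>)"
        by (simp add: indicator_def sum.If_cases Int_def)
      \<comment> \<open>Each index \<open>j \<le> m\<close> has weight at least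
        \<open>m powr (- \<gamma>)\<close>, so the count is at most \<open>m powr \<gamma>\<close>
        times the weighted sum.\<close>
      also have "\<dots> \<le> (\<Sum>j=1..m. real m powr \<gamma> * (?w j * indicator (H j) \<omega>))"
      proof (rule sum_mono)
        fix j assume "j \<in> {1..m}"
        then have "real j powr \<gamma> * ?w j \<le> real m powr \<gamma> * ?w j"
          using \<open>\<gamma> \<ge> 0\<close> by (intro mult_right_mono powr_mono2) auto
        moreover have "real j powr \<gamma> * ?w j = 1"
          using \<open>j \<in> {1..m}\<close> by (simp add: powr_add[symmetric])
        ultimately show "indicator (H j) \<omega> \<le> real m powr \<gamma> * (?w j * indicator (H j) \<omega>)"
          by (simp add: indicator_def)
      qed
      also have "\<dots> = real m powr \<gamma> * (\<Sum>j=1..m. ?w j * indicator (H j) \<omega>)"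
        by (rule sum_distrib_left[symmetric])
      also have "\<dots> \<le> real m powr \<gamma> * S"
        using le by (intro mult_left_mono) auto
      finally show "real (card {j \<in> {1..m}. \<omega> \<in> H j}) \<le> S * real m powr \<gamma>"
        by (simp add: mult.commute)
    qed
  qed
qed

end

subsection \<open>Brownian motion on an exponential scale\<close>

locale brownian_motion =
  fixes M :: "'a measure" and W :: "real \<Rightarrow> 'a \<Rightarrow> real"
  assumes standard_brownian_motion: "standard_brownian_motion M W"
begin

sublocale prob_space M
  using standard_brownian_motion by (simp add: standard_brownian_motion_def)

lemma measurable_W: "t \<ge> 0 \<Longrightarrow> W t \<in> borel_measurable M"
  and AE_W_0: "AE \<omega> in M. W 0 \<omega> = 0"
  and AE_continuous_W: "AE \<omega> in M. continuous_on {0..} (\<lambda>t. W t \<omega>)"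
  and distributed_increment: "0 \<le> s \<Longrightarrow> s < t \<Longrightarrow>
    distributed M lborel (\<lambda>\<omega>. W t \<omega> - W s \<omega>) (normal_density 0 (sqrt (t - s)))"
  and indep_increments: "0 \<le> u 0 \<Longrightarrow> (\<And>i. i < n \<Longrightarrow> u i < u (Suc i)) \<Longrightarrow>
    indep_vars (\<lambda>_. borel) (\<lambda>i \<omega>. W (u (Suc i)) \<omega> - W (u i) \<omega>) {..<n}"
  using standard_brownian_motion by (auto simp: standard_brownian_motion_def)

section \<open>Maximal inequality for Brownian motion through dyadic grids\<close>

definition grid_max_event :: "real \<Rightarrow> real \<Rightarrow> nat \<Rightarrow> 'a set" where
  "grid_max_event T l n = {\<omega> \<in> space M. \<exists>k\<le>2 ^ n. \<bar>W (T * real k / 2 ^ n) \<omega>\<bar> > l}"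

text \<open>A countable union over dyadic times keeps the event measurable; on continuous paths it
  is the event that the supremum of \<open>\<bar>W\<bar>\<close> over \<open>[0, T]\<close> exceeds
  \<open>l\<close>.\<close>

definition max_event :: "real \<Rightarrow> real \<Rightarrow> 'a set" where
  "max_event T l = (\<Union>n. grid_max_event T l n)"

lemma grid_max_event_sets: "T > 0 \<Longrightarrow> grid_max_event T l n \<in> events"
proof -
  assume "T > 0"
  have "grid_max_event T l n = (\<Union>k\<in>{..2 ^ n}. {\<omega> \<in> space M. \<bar>W (T * real k / 2 ^ n) \<omega>\<bar> > l})"
    by (auto simp: grid_max_event_def)
  also have "\<dots> \<in> events"
    using \<open>T > 0\<close> by (intro sets.countable_UN'' borel_measurable_less borel_measurable_abs measurable_W) auto
  finally show ?thesis .
qed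

lemma max_event_sets: "T > 0 \<Longrightarrow> max_event T l \<in> events"
  using grid_max_event_sets by (auto simp: max_event_def)

text \<open>The discrete maximal inequality is applied to the increments and to their negatives.
  Each sign costs a factor 2, and the endpoint is normal with variance \<open>T\<close>.\<close>

lemma prob_grid_max_event_le:
  assumes "T > 0" "l \<ge> 0"
  shows "prob (grid_max_event T l n) \<le> 4 * exp (- l\<^sup>2 / (2 * T))"
proof -
  define N :: nat where "N = 2 ^ n"
  define u where "u k = T * real k / 2 ^ n" for k :: nat
  define X where "X i \<omega> = W (u (Suc i)) \<omega> - W (u i) \<omega>" for i \<omega>
  have u: "u 0 = 0" "u N = T" "u k \<ge> 0" "i < j \<Longrightarrow> u i < u j" for i j k
    using \<open>T > 0\<close> by (auto simp: u_def N_def divide_strict_right_mono)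
  have ind: "indep_vars (\<lambda>_. borel) X {..<N}"
    unfolding X_def[abs_def] using u by (intro indep_increments) auto
  then have ind': "indep_vars (\<lambda>_. borel) (\<lambda>i \<omega>. - X i \<omega>) {..<N}"
    by (rule indep_vars_compose2) auto
  have sum: "(\<Sum>i<k. X i \<omega>) = W (u k) \<omega> - W 0 \<omega>" for k \<omega>
    using u(1) sum_lessThan_telescope[of "\<lambda>i. W (u i) \<omega>" k] by (simp add: X_def)
  have sum': "(\<Sum>i=k..<N. X i \<omega>) = W T \<omega> - W (u k) \<omega>" if "k \<le> N" for k \<omega>
    using sum_Suc_diff'[of k N "\<lambda>i. W (u i) \<omega>"] u(2) that by (simp add: X_def)
  have dist: "distributed M lborel (\<lambda>\<omega>. W T \<omega> - W (u k) \<omega>) (normal_density 0 (sqrt (T - u k)))"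
    "sqrt (T - u k) > 0" if "k < N" for k
    using distributed_increment[of "u k" T] u(2,3) u(4)[OF that] by auto
  have med: "prob {\<omega> \<in> space M. (\<Sum>i=k..<N. X i \<omega>) \<ge> 0} \<ge> 1 / 2"
    "prob {\<omega> \<in> space M. (\<Sum>i=k..<N. - X i \<omega>) \<ge> 0} \<ge> 1 / 2" if k: "k \<le> N" for k
  proof -
    \<comment> \<open>At \<open>k = N\<close> the sum is empty: it has no normal density, but it is
      nonnegative with probability 1.\<close>
    consider "k = N" | "k < N" using k by linarith
    then have "prob {\<omega> \<in> space M. (\<Sum>i=k..<N. X i \<omega>) \<ge> 0} \<ge> 1 / 2 \<and>
      prob {\<omega> \<in> space M. (\<Sum>i=k..<N. - X i \<omega>) \<ge> 0} \<ge> 1 / 2"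
    proof cases
      case 1
      then show ?thesis by (simp add: prob_space)
    next
      case 2
      show ?thesis
        using normal_prob_ge_0[OF dist[OF 2]] normal_prob_ge_0[OF distributed_normal_uminus dist(2)[OF 2], OF dist[OF 2]]
        by (simp add: sum_negf sum' k)
    qed
    then show "prob {\<omega> \<in> space M. (\<Sum>i=k..<N. X i \<omega>) \<ge> 0} \<ge> 1 / 2"
      "prob {\<omega> \<in> space M. (\<Sum>i=k..<N. - X i \<omega>) \<ge> 0} \<ge> 1 / 2" by auto
  qed
  have T: "distributed M lborel (\<lambda>\<omega>. W T \<omega> - W 0 \<omega>) (normal_density 0 (sqrt T))" "sqrt T > 0"
    using distributed_increment[of 0 T] \<open>T > 0\<close> by auto
  have [measurable]: "W (u k) \<in> borel_measurable M" "W 0 \<in> borel_measurable M" "W T \<in> borel_measurable M" for k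
    using \<open>T > 0\<close> u by (auto intro: measurable_W)
  have tail: "prob {\<omega> \<in> space M. Y \<omega> > l} \<le> exp (- l\<^sup>2 / (2 * T))"
    if "distributed M lborel Y (normal_density 0 (sqrt T))" for Y
  proof -
    have [measurable]: "Y \<in> borel_measurable M"
      using distributed_measurable[OF that] by simp
    have "prob {\<omega> \<in> space M. Y \<omega> > l} \<le> prob {\<omega> \<in> space M. Y \<omega> \<ge> l}"
      by (intro finite_measure_mono) auto
    also have "\<dots> \<le> exp (- l\<^sup>2 / (2 * (sqrt T)\<^sup>2))"
      by (rule normal_upper_tail[OF that T(2) \<open>l \<ge> 0\<close>])
    finally show ?thesis using \<open>T > 0\<close> by simp
  qed
  let ?P = "{\<omega> \<in> space M. \<exists>k\<le>N. (\<Sum>i<k. X i \<omega>) > l}"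
  let ?Q = "{\<omega> \<in> space M. \<exists>k\<le>N. (\<Sum>i<k. - X i \<omega>) > l}"
  have PQ: "?P \<in> events" "?Q \<in> events"
    unfolding sum_negf sum by measurable
  have "prob (grid_max_event T l n) \<le> prob (?P \<union> ?Q)"
  proof (rule finite_measure_mono_AE)
    \<comment> \<open>The partial sums are \<open>W (u k) - W 0\<close>, and \<open>W 0 = 0\<close>
      holds only almost surely.\<close>
    show "AE \<omega> in M. \<omega> \<in> grid_max_event T l n \<longrightarrow> \<omega> \<in> ?P \<union> ?Q"
      using AE_W_0
    proof eventually_elim
      case (elim \<omega>)
      show ?case
      proof
        assume "\<omega> \<in> grid_max_event T l n"
        then obtain k where "\<omega> \<in> space M" "k \<le> N" "\<bar>W (u k) \<omega>\<bar> > l"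
          by (auto simp: grid_max_event_def u_def N_def)
        moreover from this(3) have "W (u k) \<omega> > l \<or> - W (u k) \<omega> > l"
          by linarith
        ultimately show "\<omega> \<in> ?P \<union> ?Q"
          unfolding sum_negf sum using elim by auto
      qed
    qed
  qed (rule sets.Un[OF PQ])
  also have "\<dots> \<le> prob ?P + prob ?Q"
    using PQ by (rule measure_Un_le)
  also have "\<dots> \<le> 2 * prob {\<omega> \<in> space M. (\<Sum>i<N. X i \<omega>) > l} + 2 * prob {\<omega> \<in> space M. (\<Sum>i<N. - X i \<omega>) > l}"
    using med by (intro add_mono Levy_maximal_inequality ind ind') auto
  also have "\<dots> \<le> 4 * exp (- l\<^sup>2 / (2 * T))"
    using tail[OF T(1)] tail[OF distributed_normal_uminus[OF T]] u(2) by (simp add: sum_negf sum)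
  finally show ?thesis .
qed

text \<open>The grids refine each other and the grid bound does not depend on \<open>n\<close>, so
  continuity from below carries it to the union.\<close>

lemma prob_max_event_le:
  assumes "T > 0" "l \<ge> 0"
  shows "prob (max_event T l) \<le> 4 * exp (- l\<^sup>2 / (2 * T))"
proof -
  have "incseq (grid_max_event T l)"
  proof (rule incseq_SucI, rule subsetI)
    fix n \<omega> assume "\<omega> \<in> grid_max_event T l n"
    then obtain k where "\<omega> \<in> space M" "k \<le> 2 ^ n" "\<bar>W (T * real k / 2 ^ n) \<omega>\<bar> > l"
      by (auto simp: grid_max_event_def)
    then show "\<omega> \<in> grid_max_event T l (Suc n)"
      unfolding grid_max_event_def by (auto intro!: exI[of _ "2 * k"])
  qed
  then have "(\<lambda>n. prob (grid_max_event T l n)) \<longlonglongrightarrow> prob (max_event T l)"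
    unfolding max_event_def using grid_max_event_sets[OF \<open>T > 0\<close>] by (intro finite_Lim_measure_incseq) auto
  then show ?thesis
    by (rule LIMSEQ_le_const2) (use prob_grid_max_event_le[OF assms] in auto)
qed

text \<open>Exceeding \<open>l\<close> is an open condition along a continuous path, hence it also
  holds at a dyadic point just before \<open>t\<close>.\<close>

lemma mem_max_event:
  assumes "\<omega> \<in> space M" and cont: "continuous_on {0..} (\<lambda>t. W t \<omega>)"
    and "T > 0" "0 \<le> t" "t \<le> T" "\<bar>W t \<omega>\<bar> > l"
  shows "\<omega> \<in> max_event T l"
proof -
  have "continuous (at t within {0..}) (\<lambda>t. \<bar>W t \<omega>\<bar>)"
    using cont \<open>0 \<le> t\<close> by (intro continuous_rabs) (auto simp: continuous_on_eq_continuous_within)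
  then have "\<forall>\<^sub>F s in at t within {0..}. \<bar>W s \<omega>\<bar> > l"
    using \<open>\<bar>W t \<omega>\<bar> > l\<close> unfolding continuous_within by (rule order_tendstoD)
  then obtain d where "d > 0" and d: "\<And>s. s \<ge> 0 \<Longrightarrow> s \<noteq> t \<Longrightarrow> dist s t < d \<Longrightarrow> \<bar>W s \<omega>\<bar> > l"
    unfolding eventually_at by auto
  obtain n :: nat where n: "T / d < 2 ^ n"
    using real_arch_pow[of 2 "T / d"] by auto
  \<comment> \<open>Rounding down keeps the grid point inside \<open>[0, t]\<close>, and the choice
    of \<open>n\<close> puts it within \<open>d\<close> of \<open>t\<close>.\<close>
  define k where "k = nat \<lfloor>t * 2 ^ n / T\<rfloor>"
  have k: "real k \<le> t * 2 ^ n / T" "t * 2 ^ n / T < real k + 1"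
    using \<open>0 \<le> t\<close> \<open>T > 0\<close> by (auto simp: k_def)
  have "real k \<le> 2 ^ n"
  proof -
    have "t * 2 ^ n / T \<le> T * 2 ^ n / T"
      using \<open>t \<le> T\<close> \<open>T > 0\<close> by (intro divide_right_mono mult_right_mono) auto
    moreover have "T * 2 ^ n / T = 2 ^ n"
      using \<open>T > 0\<close> by simp
    ultimately show ?thesis using k(1) by linarith
  qed
  then have "k \<le> 2 ^ n"
    by (metis of_nat_le_iff of_nat_numeral of_nat_power)
  define s where "s = T * real k / 2 ^ n"
  have "s \<le> t" "t < s + T / 2 ^ n"
    using k \<open>T > 0\<close> by (simp_all add: s_def field_simps)
  moreover have "T / 2 ^ n < d"
    using n \<open>d > 0\<close> by (simp add: field_simps)
  moreover have "s \<ge> 0"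
    using \<open>T > 0\<close> by (simp add: s_def)
  ultimately have "\<bar>W s \<omega>\<bar> > l"
    using d[of s] \<open>\<bar>W t \<omega>\<bar> > l\<close> by (cases "s = t") (auto simp: dist_real_def)
  then show ?thesis
    using \<open>k \<le> 2 ^ n\<close> \<open>\<omega> \<in> space M\<close> by (auto simp: max_event_def grid_max_event_def s_def)
qed

section \<open>The exceedance set in logarithmic time, and the upper bound on its occupied
  cells\<close>

definition exceedance :: "real \<Rightarrow> real \<Rightarrow> 'a \<Rightarrow> real set" where
  "exceedance \<kappa> c \<omega> = {s. s > 1 \<and> (W (exp s) \<omega>)\<^sup>2 / exp s > 2 * \<kappa> * ln s - c}"

text \<open>Cutting the cell into \<open>n\<close> pieces reduces the loss of the maximal inequality on the exponent
  to a factor \<open>exp (- 1 / n)\<close>. If the level is not positive, the cell may be hit at a zero of \<open>W\<close>,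
  so nothing smaller than the whole space is claimed to cover.\<close>

definition hit_cover :: "real \<Rightarrow> real \<Rightarrow> nat \<Rightarrow> nat \<Rightarrow> 'a set" where
  "hit_cover \<kappa> c n j = (if 2 * \<kappa> * ln (real j) \<le> c then space M
     else \<Union>i<n. max_event (exp (real j + real (Suc i) / n))
            (sqrt (exp (real j + real i / n) * (2 * \<kappa> * ln (real j) - c))))"

lemma hit_cover_sets: "hit_cover \<kappa> c n j \<in> events"
  by (auto simp: hit_cover_def intro!: max_event_sets)

lemma prob_hit_cover_le:
  assumes "n > 0" "j \<ge> 1"
  shows "prob (hit_cover \<kappa> c n j)
    \<le> 4 * real n * exp (c * exp (- 1 / n) / 2) * real j powr (- (\<kappa> * exp (- 1 / n)))"
proof -
  let ?L = "2 * \<kappa> * ln (real j) - c" and ?q = "exp (- 1 / real n)"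
  \<comment> \<open>The claimed bound is rewritten in terms of the level \<open>?L\<close>; the
    constant \<open>c\<close> contributes only a factor independent of \<open>j\<close>.\<close>
  have rhs: "4 * real n * exp (c * ?q / 2) * real j powr (- (\<kappa> * ?q)) = 4 * real n * exp (- ?L * ?q / 2)"
    using \<open>j \<ge> 1\<close> by (simp add: powr_def exp_add[symmetric] field_simps)
  show ?thesis
  proof (cases "?L \<le> 0")
    case True
    \<comment> \<open>For a nonpositive level the right-hand side is at least \<open>4 * n\<close>,
      so the trivial bound 1 is enough.\<close>
    have "prob (hit_cover \<kappa> c n j) \<le> 1 * 1" by simp
    also have "\<dots> \<le> (4 * real n) * exp (- ?L * ?q / 2)"
      using True \<open>n > 0\<close> by (intro mult_mono) (auto simp: mult_nonpos_nonneg)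
    finally show ?thesis unfolding rhs by simp
  next
    case False
    let ?E = "\<lambda>i. max_event (exp (real j + real (Suc i) / n)) (sqrt (exp (real j + real i / n) * ?L))"
    have E: "prob (?E i) \<le> 4 * exp (- ?L * ?q / 2)" for i
    proof -
      have "prob (?E i) \<le> 4 * exp (- (sqrt (exp (real j + real i / n) * ?L))\<^sup>2 / (2 * exp (real j + real (Suc i) / n)))"
        using False by (intro prob_max_event_le) auto
      \<comment> \<open>The level uses the left end of a piece and the time horizon its right end;
        their ratio produces the factor \<open>?q\<close>.\<close>
      also have "(sqrt (exp (real j + real i / n) * ?L))\<^sup>2 = exp (real j + real (Suc i) / n) * (?q * ?L)"
      proof -
        have "real j + real i / n = (real j + real (Suc i) / n) + (- 1 / n)"
          using \<open>n > 0\<close> by (simp add: field_simps)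
        then show ?thesis
          using False by (simp only: exp_add mult.assoc) simp
      qed
      also have "- (exp (real j + real (Suc i) / n) * (?q * ?L)) / (2 * exp (real j + real (Suc i) / n)) = - ?L * ?q / 2"
      proof -
        have "- (z * (q * L)) / (2 * z) = - L * q / 2" if "z > 0" for z q L :: real
          using that by (simp add: field_simps)
        from this[OF exp_gt_zero] show ?thesis .
      qed
      finally show ?thesis .
    qed
    have "prob (hit_cover \<kappa> c n j) = prob (\<Union>i<n. ?E i)"
      using False by (simp add: hit_cover_def)
    also have "\<dots> \<le> (\<Sum>i<n. prob (?E i))"
      by (intro finite_measure_subadditive_finite) (auto intro!: max_event_sets)
    also have "\<dots> \<le> (\<Sum>i<n. 4 * exp (- ?L * ?q / 2))"
      by (intro sum_mono E)
    finally show ?thesis unfolding rhs by simp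
  qed
qed

text \<open>On the cell the threshold at \<open>s\<close> is at least the one at its left end
  \<open>j\<close>, because \<open>ln\<close> increases. A hit at \<open>s\<close> is then charged
  to the piece containing \<open>s\<close>.\<close>

lemma mem_hit_cover:
  assumes "\<omega> \<in> space M" and cont: "continuous_on {0..} (\<lambda>t. W t \<omega>)"
    and "\<kappa> > 0" "n > 0" "j \<ge> 1" and hit: "{real j..real j + 1} \<inter> exceedance \<kappa> c \<omega> \<noteq> {}"
  shows "\<omega> \<in> hit_cover \<kappa> c n j"
proof (cases "2 * \<kappa> * ln (real j) \<le> c")
  case False
  let ?L = "2 * \<kappa> * ln (real j) - c"
  from hit obtain s where s: "real j \<le> s" "s \<le> real j + 1" "(W (exp s) \<omega>)\<^sup>2 / exp s > 2 * \<kappa> * ln s - c"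
    by (auto simp: exceedance_def)
  have "2 * \<kappa> * ln (real j) \<le> 2 * \<kappa> * ln s"
    using s \<open>j \<ge> 1\<close> \<open>\<kappa> > 0\<close> by (intro mult_left_mono) auto
  then have "(W (exp s) \<omega>)\<^sup>2 / exp s > ?L"
    using s(3) by linarith
  then have W: "(W (exp s) \<omega>)\<^sup>2 > exp s * ?L"
    by (simp add: pos_less_divide_eq mult.commute)
  \<comment> \<open>At the right end of the cell the floor would be \<open>n\<close>, which is out
    of range, so the last piece is used.\<close>
  define i where "i = (if s = real j + 1 then n - 1 else nat \<lfloor>(s - j) * n\<rfloor>)"
  have i: "i < n" "real j + real i / n \<le> s" "s \<le> real j + real (Suc i) / n"
  proof -
    have "i < n \<and> real i \<le> (s - j) * n \<and> (s - j) * n \<le> real (Suc i)"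
    proof (cases "s = real j + 1")
      case True
      then show ?thesis using \<open>n > 0\<close> by (auto simp: i_def of_nat_diff)
    next
      case False
      have "(s - j) * n < 1 * real n"
        using False s(2) \<open>n > 0\<close> by (intro mult_strict_right_mono) auto
      then have "nat \<lfloor>(s - j) * n\<rfloor> < n"
        using s(1) by (simp add: nat_less_iff floor_less_iff)
      moreover have "(s - j) * n \<ge> 0" using s(1) by simp
      ultimately show ?thesis
        using False by (simp add: i_def) linarith
    qed
    moreover from this have "real i / n \<le> s - j" "s - j \<le> real (Suc i) / n"
      using \<open>n > 0\<close> by (simp_all only: pos_divide_le_eq pos_le_divide_eq of_nat_0_less_iff)
    ultimately show "i < n" "real j + real i / n \<le> s" "s \<le> real j + real (Suc i) / n"
      by linarith+
  qed
  have "sqrt (exp (real j + real i / n) * ?L) < \<bar>W (exp s) \<omega>\<bar>"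
  proof (rule real_less_lsqrt)
    have "exp (real j + real i / n) * ?L \<le> exp s * ?L"
      using i(2) False by (intro mult_right_mono) auto
    then show "exp (real j + real i / n) * ?L < \<bar>W (exp s) \<omega>\<bar>\<^sup>2"
      using W by simp
  qed simp
  then have "\<omega> \<in> max_event (exp (real j + real (Suc i) / n)) (sqrt (exp (real j + real i / n) * ?L))"
    using i(3) assms(1,2) by (intro mem_max_event[where t = "exp s"]) simp_all
  then show ?thesis
    unfolding hit_cover_def using False i(1) by (simp only: if_False) blast
qed (use assms in \<open>simp add: hit_cover_def\<close>)

lemma AE_unit_cells_le:
  assumes "\<kappa> > 0" "\<epsilon> > 0"
  shows "AE \<omega> in M. \<exists>K. \<forall>m\<ge>1. real (unit_cells (exceedance \<kappa> c \<omega>) m) \<le> K * real m powr (max (1 - \<kappa>) 0 + \<epsilon>)"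
proof -
  \<comment> \<open>Since \<open>exp (- 1 / n) \<ge> 1 - 1 / n\<close>, this choice loses less than
    \<open>\<epsilon>\<close> from the exponent \<open>\<kappa>\<close>, so that the two exponents
    add up to more than 1.\<close>
  obtain n :: nat where n: "n > \<kappa> / \<epsilon>"
    using reals_Archimedean2 by blast
  then have "n > 0"
    using assms by (metis divide_pos_pos of_nat_0_less_iff order_less_trans)
  let ?\<gamma> = "max (1 - \<kappa>) 0 + \<epsilon>"
  have "\<kappa> / n < \<epsilon>"
    using n \<open>n > 0\<close> \<open>\<epsilon> > 0\<close> by (simp add: field_simps)
  moreover have "\<kappa> * (1 + (- 1 / n)) \<le> \<kappa> * exp (- 1 / n)"
    using \<open>\<kappa> > 0\<close> by (intro mult_left_mono exp_ge_add_one_self) auto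
  ultimately have "\<kappa> * exp (- 1 / n) + ?\<gamma> > 1"
    by (simp add: algebra_simps)
  then have "AE \<omega> in M. \<exists>S\<ge>0. \<forall>m. real (card {j \<in> {1..m}. \<omega> \<in> hit_cover \<kappa> c n j}) \<le> S * real m powr ?\<gamma>"
    using assms by (intro AE_count_events_le_powr[OF hit_cover_sets prob_hit_cover_le[OF \<open>n > 0\<close>]]) auto
  then show ?thesis
    using AE_continuous_W AE_space
  proof eventually_elim
    case (elim \<omega>)
    then obtain S where "S \<ge> 0" and S: "\<And>m. real (card {j \<in> {1..m}. \<omega> \<in> hit_cover \<kappa> c n j}) \<le> S * real m powr ?\<gamma>"
      by auto
    show ?case
    proof (intro exI[of _ "1 + S"] allI impI)
      fix m :: nat assume "m \<ge> 1"
      \<comment> \<open>The covering starts at \<open>j = 1\<close>. Cell 0 adds at most one to the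
        count, which is absorbed because \<open>m powr ?\<gamma> \<ge> 1\<close>.\<close>
      have "{j \<in> {0..m}. {real j..real j + 1} \<inter> exceedance \<kappa> c \<omega> \<noteq> {}}
          \<subseteq> insert 0 {j \<in> {1..m}. \<omega> \<in> hit_cover \<kappa> c n j}"
        using mem_hit_cover[OF elim(3,2) \<open>\<kappa> > 0\<close> \<open>n > 0\<close>] by (force simp: not_less_eq_eq)
      then have "unit_cells (exceedance \<kappa> c \<omega>) m \<le> card (insert 0 {j \<in> {1..m}. \<omega> \<in> hit_cover \<kappa> c n j})"
        unfolding unit_cells_def by (intro card_mono) auto
      also have "\<dots> \<le> Suc (card {j \<in> {1..m}. \<omega> \<in> hit_cover \<kappa> c n j})"
        by (rule card_insert_le_m1) auto
      finally have "real (unit_cells (exceedance \<kappa> c \<omega>) m) \<le> 1 + S * real m powr ?\<gamma>"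
        using S[of m] by linarith
      moreover have "1 \<le> real m powr ?\<gamma>"
        using \<open>m \<ge> 1\<close> \<open>\<epsilon> > 0\<close> by (intro ge_one_powr_ge_zero) auto
      ultimately show "real (unit_cells (exceedance \<kappa> c \<omega>) m) \<le> (1 + S) * real m powr ?\<gamma>"
        unfolding distrib_right by linarith
    qed
  qed
qed

end

subsection \<open>The lower bound\<close>

lemma summable_exp_minus_powr:
  fixes a \<beta> :: real
  assumes "a > 0" "\<beta> > 0"
  shows "summable (\<lambda>n. exp (- (a * real n powr \<beta>)))"
proof (rule summable_comparison_test_bigo)
  show "(\<lambda>n. exp (- (a * real n powr \<beta>))) \<in> O(\<lambda>n. real n powr (- 2))"
    using assms by real_asymp
  show "summable (\<lambda>n. norm (real n powr (- 2)))"
    by (simp add: summable_real_powr_iff)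
qed

text \<open>Chernoff's method: Markov's inequality for \<open>exp (- count)\<close>, a product of
  independent factors of mean at most \<open>exp (- 3 p / 5)\<close>. The exponent left over is
  \<open>3/5 - 1/2 = 1/10\<close>.\<close>

lemma (in prob_space) prob_few_exceedances_le:
  fixes X :: "nat \<Rightarrow> 'a \<Rightarrow> real"
  assumes ind: "indep_vars (\<lambda>_. borel) X {..<n}"
    and p: "\<And>i. i < n \<Longrightarrow> prob {\<omega> \<in> space M. X i \<omega> > x i} \<ge> p"
  shows "prob {\<omega> \<in> space M. real (card {i \<in> {..<n}. X i \<omega> > x i}) \<le> real n * p / 2}
    \<le> exp (- (real n * p / 10))"
proof -
  have X[measurable]: "X i \<in> borel_measurable M" if "i < n" for i
    using ind that by (auto simp: indep_vars_def)
  define Y where "Y i \<omega> = (if X i \<omega> > x i then exp (- 1) else 1 :: real)" for i \<omega>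
  have Y_prod: "(\<Prod>i<n. Y i \<omega>) = exp (- real (card {i \<in> {..<n}. X i \<omega> > x i}))" for \<omega>
    by (simp add: Y_def prod.If_cases Int_def exp_of_nat_mult[symmetric] flip: exp_minus)
  have "indep_vars (\<lambda>_. borel) (\<lambda>i \<omega>. (if X i \<omega> > x i then exp (- 1) else 1 :: real)) {..<n}"
    by (rule indep_vars_compose2[OF ind, where Y = "\<lambda>i y. if y > x i then exp (- 1) else 1"]) measurable
  then have indY: "indep_vars (\<lambda>_. borel) Y {..<n}"
    by (simp add: Y_def[abs_def])
  have Y_int: "integrable M (Y i)" if "i < n" for i
    unfolding Y_def using that by (intro integrable_const_bound[where B = 1]) auto
  have EY: "expectation (Y i) \<le> exp (- (3 / 5 * p))" if "i < n" for i
  proof -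
    let ?E = "{\<omega> \<in> space M. X i \<omega> > x i}"
    have E: "?E \<in> events" using that by measurable
    have "expectation (Y i) = expectation (\<lambda>\<omega>. 1 - (1 - exp (- 1)) * indicator ?E \<omega>)"
      by (intro Bochner_Integration.integral_cong) (auto simp: Y_def)
    also have "\<dots> = 1 - (1 - exp (- 1)) * prob ?E"
      using E by (subst Bochner_Integration.integral_diff)
        (auto simp: prob_space emeasure_eq_measure intro!: integrable_mult_right integrable_real_indicator)
    also have "\<dots> \<le> 1 - 3 / 5 * p"
    proof -
      \<comment> \<open>The bound \<open>e \<ge> 5/2\<close> yields
        \<open>1 - exp (- 1) \<ge> 3/5\<close>.\<close>
      have "exp (1 :: real) \<ge> 1 + 1 + 1\<^sup>2 / 2"
        by (rule exp_lower_Taylor_quadratic) simp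
      then have "exp (- 1 :: real) \<le> 2 / 5"
        by (simp add: exp_minus inverse_eq_divide pos_divide_le_eq)
      then have "3 / 5 * prob ?E \<le> (1 - exp (- 1)) * prob ?E"
        by (intro mult_right_mono) auto
      moreover have "3 / 5 * p \<le> 3 / 5 * prob ?E"
        using p[OF that] by simp
      ultimately show ?thesis by linarith
    qed
    also have "\<dots> \<le> exp (- (3 / 5 * p))"
      using exp_ge_add_one_self[of "- (3 / 5 * p)"] by simp
    finally show ?thesis .
  qed
  have "prob {\<omega> \<in> space M. real (card {i \<in> {..<n}. X i \<omega> > x i}) \<le> real n * p / 2}
    = prob {\<omega> \<in> space M. (\<Prod>i<n. Y i \<omega>) \<ge> exp (- (real n * p / 2))}"
    unfolding Y_prod by simp
  also have "\<dots> \<le> expectation (\<lambda>\<omega>. \<Prod>i<n. Y i \<omega>) / exp (- (real n * p / 2))"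
  proof (rule integral_Markov_inequality_measure[where A = "{}"])
    show "integrable M (\<lambda>\<omega>. \<Prod>i<n. Y i \<omega>)"
      using indY Y_int by (intro indep_vars_integrable) auto
    show "AE \<omega> in M. 0 \<le> (\<Prod>i<n. Y i \<omega>)"
      by (intro AE_I2 prod_nonneg) (auto simp: Y_def)
  qed auto
  also have "expectation (\<lambda>\<omega>. \<Prod>i<n. Y i \<omega>) = (\<Prod>i<n. expectation (Y i))"
    using indY Y_int by (intro indep_vars_lebesgue_integral) auto
  also have "\<dots> \<le> (\<Prod>i<n. exp (- (3 / 5 * p)))"
    using EY by (intro prod_mono conjI integral_nonneg_AE AE_I2) (auto simp: Y_def)
  also have "\<dots> = exp (- (real n * (3 / 5 * p)))"
    by (simp add: exp_of_nat_mult[symmetric])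
  also have "\<dots> / exp (- (real n * p / 2)) = exp (- (real n * p / 10))"
    by (simp add: exp_diff[symmetric])
  finally show ?thesis
    by (simp add: divide_right_mono)
qed

context brownian_motion
begin

text \<open>The factor 2 turns the Gaussian tail into a multiple of
  \<open>1 / (i + 1)\<^sup>2\<close>, summable for Borel-Cantelli. The logarithm is taken at the
  next time \<open>Suc i * b\<close>, where the threshold is tested later.\<close>

lemma AE_eventually_abs_less:
  assumes "b > 0"
  shows "AE \<omega> in M. \<forall>\<^sub>F i in sequentially.
    \<bar>W (exp (real (i * b))) \<omega>\<bar> < 2 * sqrt (ln (real (Suc i * b))) * sqrt (exp (real (i * b)))"
proof -
  define u where "u i = exp (real (i * b))" for i
  define y where "y i = 2 * sqrt (ln (real (Suc i * b))) * sqrt (u i)" for i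
  define A where "A i = {\<omega> \<in> space M. \<bar>W (u i) \<omega> - W 0 \<omega>\<bar> \<ge> y i}" for i
  have u: "u i > 0" for i by (simp add: u_def)
  have [measurable]: "W (u i) \<in> borel_measurable M" "W 0 \<in> borel_measurable M" for i
    using u[of i] by (auto intro: measurable_W)
  have A: "A i \<in> events" for i
    unfolding A_def by measurable
  have pA: "prob (A i) \<le> 2 * (1 / real (Suc i) ^ 2)" for i
  proof -
    have j: "real (Suc i * b) \<ge> real (Suc i)" "real (Suc i) > 0"
    proof -
      have "Suc i * 1 \<le> Suc i * b" using \<open>b > 0\<close> by (intro mult_le_mono2) simp
      then show "real (Suc i * b) \<ge> real (Suc i)" by (simp only: of_nat_le_iff mult_1_right)
    qed simp
    then have ln0: "ln (real (Suc i * b)) \<ge> 0"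
      by (intro ln_ge_zero) linarith
    have "prob (A i) \<le> 2 * exp (- (y i)\<^sup>2 / (2 * (sqrt (u i - 0))\<^sup>2))"
      unfolding A_def using u[of i] ln0
      by (intro normal_abs_tail distributed_increment) (auto simp: y_def)
    also have "- (y i)\<^sup>2 / (2 * (sqrt (u i - 0))\<^sup>2) = - 2 * ln (real (Suc i * b))"
      using u[of i] ln0 by (simp add: y_def power_mult_distrib)
    also have "\<dots> \<le> - 2 * ln (real (Suc i))"
      using j by (simp only: mult_le_cancel_left_neg) (subst ln_le_cancel_iff, auto)
    also have "exp (- 2 * ln (real (Suc i))) = 1 / real (Suc i) ^ 2"
      by (simp add: exp_minus exp_of_nat_mult[of 2, simplified] inverse_eq_divide)
    finally show ?thesis by simp
  qed
  have "summable (\<lambda>i. prob (A i))"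
  proof (rule summable_comparison_test'[where N = 0])
    have "summable (\<lambda>i. 1 / real i ^ 2)"
      using inverse_power_summable[of 2, where ?'a = real] by (simp add: inverse_eq_divide)
    then show "summable (\<lambda>i. 2 * (1 / real (Suc i) ^ 2))"
      by (intro summable_mult) (simp only: summable_Suc_iff[of "\<lambda>i. 1 / real i ^ 2"])
    show "norm (prob (A i)) \<le> 2 * (1 / real (Suc i) ^ 2)" for i
      using pA[of i] by simp
  qed
  then have "AE \<omega> in M. \<forall>\<^sub>F i in sequentially. \<omega> \<in> space M - A i"
    using A by (intro borel_cantelli_AE1) (auto simp: emeasure_eq_measure)
  then show ?thesis
    using AE_W_0
  proof eventually_elim
    case (elim \<omega>)
    from elim(1) show ?case
      by eventually_elim (use elim(2) in \<open>auto simp: A_def u_def y_def\<close>)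
  qed
qed

text \<open>Each of the first \<open>n\<close> normalised increments is large with probability at
  least a multiple of \<open>n powr (- \<kappa>')\<close>. The chance of seeing fewer than half the
  resulting number is summable in \<open>n\<close>, so Borel-Cantelli applies.\<close>

lemma AE_eventually_many_large_increments:
  assumes "b > 0" "0 < \<kappa>" "\<kappa> < \<kappa>'" "\<kappa>' < 1"
  shows "\<exists>a>0. AE \<omega> in M. \<forall>\<^sub>F n in sequentially.
    a * real n powr (1 - \<kappa>') < real (card {i \<in> {..<n}.
      W (exp (real (Suc i * b))) \<omega> - W (exp (real (i * b))) \<omega>
        > sqrt (exp (real (Suc i * b)) - exp (real (i * b))) * sqrt (2 * \<kappa> * ln (real (Suc i * b)))})"
proof -
  define u where "u i = exp (real (i * b))" for i
  define X where "X i \<omega> = W (u (Suc i)) \<omega> - W (u i) \<omega>" for i \<omega>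
  define x where "x i = sqrt (2 * \<kappa> * ln (real (Suc i * b)))" for i
  define t where "t i = sqrt (u (Suc i) - u i) * x i" for i
  \<comment> \<open>\<open>(x + 1)\<^sup>2 \<le> (1 + \<theta>) x\<^sup>2 + 1 + 1 / \<theta>\<close> absorbs the shift in the Gaussian lower tail into \<open>\<kappa>'\<close>.\<close>
  define \<theta> where "\<theta> = \<kappa>' / \<kappa> - 1"
  have "\<theta> > 0" using assms by (simp add: \<theta>_def)
  \<comment> \<open>The first factors are what remains of the lower tail after the shift is
    absorbed; \<open>b powr (- \<kappa>')\<close> converts \<open>n * b\<close> into
    \<open>n\<close>.\<close>
  define a where "a = exp (- ((1 + 1 / \<theta>) / 2)) / sqrt (2 * pi) * real b powr (- \<kappa>')"
  have "a > 0" using \<open>b > 0\<close> by (simp add: a_def)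
  have u: "u i > 0" "u i < u (Suc i)" for i
    using \<open>b > 0\<close> by (auto simp: u_def)
  have [measurable]: "X i \<in> borel_measurable M" for i
    unfolding X_def[abs_def] using u by (intro borel_measurable_diff measurable_W) (auto simp: less_imp_le)
  have ind: "indep_vars (\<lambda>_. borel) X {..<n}" for n
    unfolding X_def[abs_def] using u by (intro indep_increments) (auto simp: less_imp_le)
  have p: "prob {\<omega> \<in> space M. X i \<omega> > t i} \<ge> a * real n powr (- \<kappa>')" if "i < n" for i n
  proof -
    have j: "1 \<le> real (Suc i * b)" "real (Suc i * b) \<le> real (n * b)"
    proof -
      have "Suc i * b \<le> n * b" using that by (intro mult_right_mono) auto
      then show "real (Suc i * b) \<le> real (n * b)" by (simp only: of_nat_le_iff)
      have "1 \<le> Suc i * b" using \<open>b > 0\<close> by simp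
      then show "1 \<le> real (Suc i * b)" by (metis of_nat_1 of_nat_le_iff)
    qed
    then have ln0: "ln (real (Suc i * b)) \<ge> 0" by simp
    have x: "x i \<ge> 0" "(x i)\<^sup>2 = 2 * \<kappa> * ln (real (Suc i * b))"
      using ln0 \<open>0 < \<kappa>\<close> by (auto simp: x_def)
    have "0 \<le> (\<theta> * x i - 1)\<^sup>2 / \<theta>"
      using \<open>\<theta> > 0\<close> by simp
    also have "\<dots> = \<theta> * (x i)\<^sup>2 - 2 * x i + 1 / \<theta>"
      using \<open>\<theta> > 0\<close> by (simp add: power2_eq_square field_simps)
    finally have "(x i + 1)\<^sup>2 \<le> (1 + \<theta>) * (x i)\<^sup>2 + (1 + 1 / \<theta>)"
      by (simp add: power2_eq_square algebra_simps)
    also have "(1 + \<theta>) * (x i)\<^sup>2 = 2 * \<kappa>' * ln (real (Suc i * b))"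
      using \<open>0 < \<kappa>\<close> unfolding x(2) by (simp add: \<theta>_def)
    \<comment> \<open>Passing to the last time makes the bound uniform in \<open>i < n\<close>,
      since the counting lemma takes a single \<open>p\<close>.\<close>
    also have "\<dots> \<le> 2 * \<kappa>' * ln (real (n * b))"
      using assms j by (intro mult_left_mono ln_mono) auto
    finally have le: "- ((1 + 1 / \<theta>) / 2) - \<kappa>' * ln (real (n * b)) \<le> - (x i + 1)\<^sup>2 / 2"
      by (simp add: field_simps)
    have "a * real n powr (- \<kappa>') = exp (- ((1 + 1 / \<theta>) / 2)) * real (n * b) powr (- \<kappa>') / sqrt (2 * pi)"
      by (simp add: a_def powr_mult)
    also have "\<dots> = exp (- ((1 + 1 / \<theta>) / 2) - \<kappa>' * ln (real (n * b))) / sqrt (2 * pi)"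
    proof -
      have "real (n * b) > 0" using j by linarith
      then have "real (n * b) powr (- \<kappa>') = exp (- \<kappa>' * ln (real (n * b)))"
        unfolding powr_def by (metis less_irrefl)
      then show ?thesis
        by (simp only: exp_add[symmetric]) simp
    qed
    also have "\<dots> \<le> exp (- (x i + 1)\<^sup>2 / 2) / sqrt (2 * pi)"
      using le by (intro divide_right_mono) auto
    also have "\<dots> \<le> prob {\<omega> \<in> space M. X i \<omega> > t i}"
      unfolding X_def t_def using u[of i] x(1)
      by (intro normal_lower_tail distributed_increment) auto
    finally show ?thesis .
  qed
  define B where "B n = {\<omega> \<in> space M. real (card {i \<in> {..<n}. X i \<omega> > t i}) \<le> real n * (a * real n powr (- \<kappa>')) / 2}" for n
  have eq: "real n * (a * real n powr (- \<kappa>')) = a * real n powr (1 - \<kappa>')" for n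
    by (cases "n = 0") (simp_all add: powr_diff powr_minus field_simps)
  have B: "B n \<in> events" for n
    unfolding B_def by measurable
  have "summable (\<lambda>n. prob (B n))"
  proof (rule summable_comparison_test'[where N = 0])
    show "summable (\<lambda>n. exp (- (a / 10 * real n powr (1 - \<kappa>'))))"
      using \<open>a > 0\<close> assms by (intro summable_exp_minus_powr) auto
    show "norm (prob (B n)) \<le> exp (- (a / 10 * real n powr (1 - \<kappa>')))" for n
      using prob_few_exceedances_le[of X n "a * real n powr (- \<kappa>')" t, OF ind p] unfolding B_def eq by simp
  qed
  then have "AE \<omega> in M. \<forall>\<^sub>F n in sequentially. \<omega> \<in> space M - B n"
    using B by (intro borel_cantelli_AE1) (auto simp: emeasure_eq_measure)
  then have "AE \<omega> in M. \<forall>\<^sub>F n in sequentially. a / 2 * real n powr (1 - \<kappa>') < real (card {i \<in> {..<n}. X i \<omega> > t i})"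
  proof eventually_elim
    case (elim \<omega>)
    then show ?case
      by eventually_elim (auto simp: B_def eq)
  qed
  then show ?thesis
    using \<open>a > 0\<close> unfolding X_def t_def x_def u_def by (intro exI[of _ "a / 2"]) auto
qed

text \<open>Three exponents interact: increments are tested at the level of
  \<open>\<kappa>\<^sub>1\<close>, they are counted with the exponent
  \<open>\<kappa> + \<epsilon>\<close> above it, and the gap between \<open>\<kappa>\<close> and
  \<open>\<kappa>\<^sub>1\<close> pays for the value at the preceding time.\<close>

lemma AE_unit_cells_ge:
  assumes "\<kappa> > 0" "\<epsilon> > 0" "\<kappa> + \<epsilon> < 1"
  shows "AE \<omega> in M. \<exists>a>0. \<forall>\<^sub>F m in sequentially.
    a * real m powr (1 - \<kappa> - \<epsilon>) \<le> real (unit_cells (exceedance \<kappa> c \<omega>) m)"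
proof -
  define \<kappa>\<^sub>1 where "\<kappa>\<^sub>1 = \<kappa> + \<epsilon> / 2"
  define \<beta> where "\<beta> = 1 - (\<kappa> + \<epsilon>)"
  have \<kappa>\<^sub>1: "0 < \<kappa>\<^sub>1" "\<kappa> < \<kappa>\<^sub>1" "\<kappa>\<^sub>1 < \<kappa> + \<epsilon>" and "\<beta> > 0"
    using assms by (auto simp: \<kappa>\<^sub>1_def \<beta>_def)
  \<comment> \<open>In units of \<open>sqrt (ln (J i)) * exp (J i / 2)\<close>, a large increment
    contributes the first term and the preceding value removes at most the second. The limit
    \<open>sqrt (2 * \<kappa>\<^sub>1)\<close> exceeds \<open>sqrt (2 * \<kappa>)\<close>.\<close>
  define \<eta> where "\<eta> b = sqrt (1 - exp (- real b)) * sqrt (2 * \<kappa>\<^sub>1) - 2 * exp (- real b / 2)" for b :: nat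
  have "\<eta> \<longlonglongrightarrow> sqrt (1 - 0) * sqrt (2 * \<kappa>\<^sub>1) - 2 * 0"
    unfolding \<eta>_def[abs_def] by (intro tendsto_intros) real_asymp+
  then have "\<forall>\<^sub>F b in sequentially. \<eta> b > sqrt (2 * \<kappa>) \<and> b > 0"
    using \<kappa>\<^sub>1 by (intro eventually_conj eventually_gt_at_top order_tendstoD(1)) auto
  then obtain b where \<eta>: "\<eta> b > sqrt (2 * \<kappa>)" and "b > 0"
    using eventually_happens'[OF sequentially_bot] by blast
  have "sqrt (2 * \<kappa>) \<ge> 0" using \<open>\<kappa> > 0\<close> by simp
  with \<eta> have \<eta>0: "\<eta> b > 0" by linarith
  have "(sqrt (2 * \<kappa>))\<^sup>2 < (\<eta> b)\<^sup>2"
    using \<eta> \<open>sqrt (2 * \<kappa>) \<ge> 0\<close> by (intro power_strict_mono) auto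
  then have \<eta>2: "(\<eta> b)\<^sup>2 > 2 * \<kappa>"
    using \<open>\<kappa> > 0\<close> by simp
  define u where "u i = exp (real (i * b))" for i
  define J where "J i = real (Suc i * b)" for i
  define V where "V i \<omega> \<longleftrightarrow> W (u (Suc i)) \<omega> - W (u i) \<omega> > sqrt (u (Suc i) - u i) * sqrt (2 * \<kappa>\<^sub>1 * ln (J i))" for i \<omega>
  obtain a where "a > 0" and a: "AE \<omega> in M. \<forall>\<^sub>F n in sequentially. a * real n powr \<beta> < real (card {i \<in> {..<n}. V i \<omega>})"
    using AE_eventually_many_large_increments[OF \<open>b > 0\<close> \<kappa>\<^sub>1(1,3) assms(3)]
    unfolding V_def u_def J_def \<beta>_def by auto
  have step: "u (Suc i) = exp (J i)" "u i = exp (J i) * exp (- real b)" for i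
    by (simp_all add: u_def J_def exp_add[symmetric] algebra_simps)
  have J_lim: "filterlim J at_top sequentially"
    unfolding J_def[abs_def] using \<open>b > 0\<close> by real_asymp
  have "filterlim (\<lambda>i. ((\<eta> b)\<^sup>2 - 2 * \<kappa>) * ln (J i)) at_top sequentially"
    using \<eta>2 by (intro filterlim_tendsto_pos_mult_at_top[OF tendsto_const] filterlim_compose[OF ln_at_top J_lim]) auto
  \<comment> \<open>The surplus over \<open>2 * \<kappa>\<close> grows with \<open>ln (J i)\<close>
    and so absorbs the constant \<open>c\<close> of either sign.\<close>
  then have large: "\<forall>\<^sub>F i in sequentially. ((\<eta> b)\<^sup>2 - 2 * \<kappa>) * ln (J i) \<ge> - c"
    by (simp add: filterlim_at_top)
  have J1: "\<forall>\<^sub>F i in sequentially. J i > 1"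
    using J_lim by (simp add: filterlim_at_top_dense)
  have AE2: "AE \<omega> in M. \<forall>\<^sub>F i in sequentially. \<bar>W (u i) \<omega>\<bar> < 2 * sqrt (ln (J i)) * sqrt (u i)"
    using AE_eventually_abs_less[OF \<open>b > 0\<close>] by (simp only: u_def J_def)
  show ?thesis
    using a AE2
  proof eventually_elim
    case (elim \<omega>)
    let ?A = "exceedance \<kappa> c \<omega>"
    from elim(2) large J1 have "\<forall>\<^sub>F i in sequentially. V i \<omega> \<longrightarrow> J i \<in> ?A"
    proof eventually_elim
      case (elim i)
      show ?case
      proof
        assume "V i \<omega>"
        define r where "r = sqrt (ln (J i)) * exp (J i / 2)"
        have ln0: "ln (J i) > 0" using elim(3) by simp
        have sq: "sqrt (exp (J i)) = exp (J i / 2)" "sqrt (exp (- real b)) = exp (- real b / 2)"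
          by (auto intro!: real_sqrt_unique simp: power2_eq_square exp_add[symmetric])
        have "u (Suc i) - u i = exp (J i) * (1 - exp (- real b))"
          by (simp add: step(1) step(2)[of i] algebra_simps)
        then have "sqrt (u (Suc i) - u i) * sqrt (2 * \<kappa>\<^sub>1 * ln (J i)) = r * (sqrt (1 - exp (- real b)) * sqrt (2 * \<kappa>\<^sub>1))"
          by (simp add: real_sqrt_mult sq r_def)
        moreover have "2 * sqrt (ln (J i)) * sqrt (u i) = r * (2 * exp (- real b / 2))"
          by (simp add: step(2) real_sqrt_mult sq r_def)
        ultimately have "W (u (Suc i)) \<omega> > r * \<eta> b"
          using \<open>V i \<omega>\<close> elim(1) unfolding V_def \<eta>_def right_diff_distrib by linarith
        moreover have "r * \<eta> b \<ge> 0"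
          using \<eta>0 ln0 by (simp add: r_def)
        ultimately have "(r * \<eta> b)\<^sup>2 < (W (exp (J i)) \<omega>)\<^sup>2"
          unfolding step(1) by (intro power_strict_mono) auto
        moreover have "(r * \<eta> b)\<^sup>2 = (\<eta> b)\<^sup>2 * ln (J i) * exp (J i)"
          using ln0 by (simp add: r_def power_mult_distrib exp_double[symmetric])
        ultimately have "(\<eta> b)\<^sup>2 * ln (J i) < (W (exp (J i)) \<omega>)\<^sup>2 / exp (J i)"
          by (simp add: pos_less_divide_eq)
        then show "J i \<in> ?A"
          using elim(2,3) by (simp add: exceedance_def left_diff_distrib)
      qed
    qed
    then obtain i0 where i0: "\<And>i. i \<ge> i0 \<Longrightarrow> V i \<omega> \<Longrightarrow> J i \<in> ?A"
      by (auto simp: eventually_at_top_linorder)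
    \<comment> \<open>Distinct indices give distinct integers \<open>Suc i * b\<close>, at most
      \<open>m\<close> exactly when \<open>i < m div b\<close>, and each is the left end of its own
      cell. Indices below \<open>i0\<close> are given away.\<close>
    have count: "card {i \<in> {..<m div b}. V i \<omega>} \<le> i0 + unit_cells ?A m" for m
    proof -
      let ?S = "{i \<in> {i0..<m div b}. V i \<omega>}"
      have "card ?S = card ((\<lambda>i. Suc i * b) ` ?S)"
        using \<open>b > 0\<close> by (intro card_image[symmetric] inj_onI) simp
      also have "\<dots> \<le> unit_cells ?A m"
        unfolding unit_cells_def
      proof (intro card_mono subsetI)
        fix j assume "j \<in> (\<lambda>i. Suc i * b) ` ?S"
        then obtain i where i: "i \<ge> i0" "Suc i \<le> m div b" "V i \<omega>" and j: "j = Suc i * b"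
          by auto
        have "j \<le> m"
          using i(2) \<open>b > 0\<close> unfolding j by (metis less_eq_div_iff_mult_less_eq)
        moreover have "real j \<in> ?A"
          using i0[OF i(1,3)] by (simp only: J_def j)
        ultimately show "j \<in> {j \<in> {0..m}. {real j..real j + 1} \<inter> ?A \<noteq> {}}"
          by fastforce
      qed simp
      finally have "card ?S \<le> unit_cells ?A m" .
      moreover have "card {i \<in> {..<m div b}. V i \<omega>} \<le> card ({..<i0} \<union> ?S)"
        by (intro card_mono) auto
      moreover have "card ({..<i0} \<union> ?S) \<le> i0 + card ?S"
        using card_Un_le[of "{..<i0}" ?S] by simp
      ultimately show ?thesis by linarith
    qed
    have div_lim: "filterlim (\<lambda>m. m div b) sequentially sequentially"
      unfolding filterlim_at_top
    proof
      fix n show "\<forall>\<^sub>F m in sequentially. n \<le> m div b"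
        using eventually_ge_at_top[of "n * b"]
        by eventually_elim (use \<open>b > 0\<close> in \<open>simp add: less_eq_div_iff_mult_less_eq\<close>)
    qed
    \<comment> \<open>For \<open>m \<ge> 2 * b\<close> one has
      \<open>m div b \<ge> m / (2 * b)\<close>, so the count is at least twice
      \<open>a' * m powr \<beta>\<close>: one half pays for \<open>i0\<close>, the other
      remains.\<close>
    define a' where "a' = a / 2 * (1 / (2 * real b)) powr \<beta>"
    have "a' > 0" using \<open>a > 0\<close> \<open>b > 0\<close> by (simp add: a'_def)
    have "filterlim (\<lambda>m. a' * real m powr \<beta>) at_top sequentially"
      using \<open>a' > 0\<close> \<open>\<beta> > 0\<close> by real_asymp
    then have "\<forall>\<^sub>F m in sequentially. a' * real m powr \<beta> \<ge> real i0"
      by (simp add: filterlim_at_top)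
    then have "\<forall>\<^sub>F m in sequentially. a' * real m powr \<beta> \<le> real (unit_cells ?A m)"
      using eventually_compose_filterlim[OF elim(1) div_lim] eventually_ge_at_top[of "2 * b"]
    proof eventually_elim
      case (elim m)
      have "m < (m div b + 1) * b"
        using \<open>b > 0\<close> by (metis Suc_eq_plus1 dividend_less_div_times mult.commute mult_Suc_right add.commute)
      then have "real m < (real (m div b) + 1) * real b"
        by (metis of_nat_1 of_nat_add of_nat_less_iff of_nat_mult)
      moreover have "2 * real b \<le> real m"
        using elim(3) by (metis of_nat_le_iff of_nat_mult of_nat_numeral)
      ultimately have "real m \<le> 2 * real b * real (m div b)"
        by (simp add: algebra_simps)
      then have "1 / (2 * real b) * real m \<le> real (m div b)"
        using \<open>b > 0\<close> by (simp add: field_simps)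
      then have "(1 / (2 * real b) * real m) powr \<beta> \<le> real (m div b) powr \<beta>"
        using \<open>\<beta> > 0\<close> by (intro powr_mono2) auto
      then have "a * ((1 / (2 * real b)) powr \<beta> * real m powr \<beta>) \<le> a * real (m div b) powr \<beta>"
        using \<open>a > 0\<close> by (intro mult_left_mono) (simp_all only: powr_mult less_imp_le)
      moreover have "a * ((1 / (2 * real b)) powr \<beta> * real m powr \<beta>) = a' * real m powr \<beta> + a' * real m powr \<beta>"
        by (simp add: a'_def)
      moreover have "real (card {i \<in> {..<m div b}. V i \<omega>}) \<le> real i0 + real (unit_cells ?A m)"
        using count[of m] by (metis of_nat_add of_nat_le_iff)
      ultimately show ?case
        using elim(1,2) by linarith
    qed
    then show ?case
      using \<open>a' > 0\<close> by (intro exI[of _ a']) (simp add: \<beta>_def diff_diff_eq)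
  qed
qed

text \<open>The null sets depend on \<open>\<epsilon>\<close>, so only the countably many values
  \<open>1 / (k + 1)\<close> are used; monotonicity of powers with base at least 1 gives the
  others.\<close>

lemma AE_has_Dim_M_exceedance:
  assumes "\<kappa> > 0"
  shows "AE \<omega> in M. has_Dim_M (exceedance \<kappa> c \<omega>) (max (1 - \<kappa>) 0)"
proof -
  let ?d = "max (1 - \<kappa>) 0" and ?e = "\<lambda>k. inverse (real (Suc k))"
  let ?C = "\<lambda>\<omega> m. real (unit_cells (exceedance \<kappa> c \<omega>) m)"
  have "AE \<omega> in M. \<forall>k. \<exists>K. \<forall>m\<ge>1. ?C \<omega> m \<le> K * real m powr (?d + ?e k)"
    using assms by (intro AE_all_countable[THEN iffD2] allI AE_unit_cells_le) auto
  moreover have "AE \<omega> in M. \<forall>k. \<kappa> + ?e k < 1 \<longrightarrow>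
      (\<exists>a>0. \<forall>\<^sub>F m in sequentially. a * real m powr (1 - \<kappa> - ?e k) \<le> ?C \<omega> m)"
    using assms by (intro AE_all_countable[THEN iffD2] allI AE_impI AE_unit_cells_ge) auto
  ultimately show ?thesis
  proof eventually_elim
    case (elim \<omega>)
    show ?case
    proof (rule has_Dim_M_I)
      fix \<epsilon> :: real assume "\<epsilon> > 0"
      then obtain k where k: "?e k < \<epsilon>"
        using reals_Archimedean by blast
      obtain K where K: "\<forall>m\<ge>1. ?C \<omega> m \<le> K * real m powr (?d + ?e k)"
        using elim(1) by blast
      show "\<exists>K. \<forall>m\<ge>1. ?C \<omega> m \<le> K * real m powr (?d + \<epsilon>)"
      proof (intro exI[of _ "max K 0"] allI impI)
        fix m :: nat assume "m \<ge> 1"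
        then have "?C \<omega> m \<le> K * real m powr (?d + ?e k)" using K by blast
        also have "\<dots> \<le> max K 0 * real m powr (?d + \<epsilon>)"
          using k \<open>m \<ge> 1\<close> by (intro mult_mono powr_mono) auto
        finally show "?C \<omega> m \<le> max K 0 * real m powr (?d + \<epsilon>)" .
      qed
    next
      fix \<epsilon> :: real assume "0 < \<epsilon>" "\<epsilon> < ?d"
      then have d: "?d = 1 - \<kappa>" by linarith
      obtain k where k: "?e k < \<epsilon>"
        using reals_Archimedean \<open>0 < \<epsilon>\<close> by blast
      then have "\<kappa> + ?e k < 1" using \<open>\<epsilon> < ?d\<close> d by linarith
      then obtain a where "a > 0" and a: "\<forall>\<^sub>F m in sequentially. a * real m powr (1 - \<kappa> - ?e k) \<le> ?C \<omega> m"
        using elim(2) by blast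
      have "\<forall>\<^sub>F m in sequentially. a * real m powr (?d - \<epsilon>) \<le> ?C \<omega> m"
        using a eventually_ge_at_top[of 1]
      proof eventually_elim
        case (elim m)
        have "a * real m powr (?d - \<epsilon>) \<le> a * real m powr (1 - \<kappa> - ?e k)"
          using \<open>a > 0\<close> k d elim(2) by (intro mult_left_mono powr_mono) auto
        then show ?case using elim(1) by linarith
      qed
      then show "\<exists>a>0. \<forall>\<^sub>F m in sequentially. a * real m powr (?d - \<epsilon>) \<le> ?C \<omega> m"
        using \<open>a > 0\<close> by blast
    qed simp
  qed
qed

end

section \<open>From the explicit kernel to the exceedance set\<close>

lemma heat_kernel_product_less_iff:
  assumes "\<nu> > 0" "r > 0" "s > 1"
  shows "heat_kernel \<nu> (exp s) 0 * heat_kernel \<nu> (exp s) (sqrt r * w) < 1 / (exp s * s powr \<delta>)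
    \<longleftrightarrow> w\<^sup>2 / exp s > 2 * (2 * \<delta> * \<nu> / r) * ln s - 4 * \<nu> / r * ln (4 * pi * \<nu>)"
proof -
  define x where "x = r * w\<^sup>2 / (4 * \<nu> * exp s)"
  define z where "z = 4 * pi * \<nu> * exp s"
  have "z > 0" using assms by (simp add: z_def)
  have "z powr (- 1 / 2) * z powr (- 1 / 2) = 1 / z"
    using \<open>z > 0\<close> by (simp add: powr_add[symmetric] powr_minus_divide)
  moreover have "heat_kernel \<nu> (exp s) 0 = z powr (- 1 / 2)"
    "heat_kernel \<nu> (exp s) (sqrt r * w) = z powr (- 1 / 2) * exp (- x)"
    using assms by (simp_all add: heat_kernel_def z_def x_def power_mult_distrib)
  ultimately have "heat_kernel \<nu> (exp s) 0 * heat_kernel \<nu> (exp s) (sqrt r * w) = 1 / z * exp (- x)"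
    by (simp only: mult.assoc[symmetric])
  also have "\<dots> = exp (- x - ln (4 * pi * \<nu>)) / exp s"
    using assms by (simp add: exp_diff z_def field_simps)
  finally have lhs: "heat_kernel \<nu> (exp s) 0 * heat_kernel \<nu> (exp s) (sqrt r * w)
      = exp (- x - ln (4 * pi * \<nu>)) / exp s" .
  have rhs: "1 / (exp s * s powr \<delta>) = exp (- \<delta> * ln s) / exp s"
    using assms by (simp add: powr_def exp_minus field_simps)
  have "heat_kernel \<nu> (exp s) 0 * heat_kernel \<nu> (exp s) (sqrt r * w) < 1 / (exp s * s powr \<delta>)
      \<longleftrightarrow> x > \<delta> * ln s - ln (4 * pi * \<nu>)"
    unfolding lhs rhs by (simp add: divide_less_cancel) linarith
  \<comment> \<open>This factor turns \<open>x\<close> into \<open>w\<^sup>2 / exp s\<close>, and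
    thereby fixes \<open>\<kappa>\<close> and \<open>c\<close>.\<close>
  also have "\<dots> \<longleftrightarrow> 4 * \<nu> / r * x > 4 * \<nu> / r * (\<delta> * ln s - ln (4 * pi * \<nu>))"
    using assms by (intro mult_less_cancel_left_pos[symmetric]) simp
  also have "4 * \<nu> / r * x = w\<^sup>2 / exp s"
    using assms by (simp add: x_def)
  also have "4 * \<nu> / r * (\<delta> * ln s - ln (4 * pi * \<nu>)) = 2 * (2 * \<delta> * \<nu> / r) * ln s - 4 * \<nu> / r * ln (4 * pi * \<nu>)"
    by (simp add: right_diff_distrib)
  finally show ?thesis .
qed

theorem theorem9p2:
  fixes M :: "'a measure"
    and W :: "real \<Rightarrow> 'a \<Rightarrow> real"
    and \<rho> :: "real \<Rightarrow> real"
    and \<nu> \<delta> :: real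
    and \<Gamma> :: "real \<Rightarrow> real \<Rightarrow> real \<Rightarrow> 'a \<Rightarrow> real"
  assumes "standard_brownian_motion M W"
    and "\<forall>x. \<rho> x = \<rho> 0" and "\<rho> 0 > 0" and "\<nu> > 0"
    and "stratonovich_solution M W \<nu> (sqrt (\<rho> 0)) \<Gamma>"
    and "AE \<omega> in M. \<forall>t>0. \<Gamma> t 0 0 \<omega> =
           heat_kernel \<nu> t 0 * heat_kernel \<nu> t (sqrt (\<rho> 0) * W t \<omega>)"
    and "\<delta> > 0"
  shows "AE \<omega> in M.
           has_Dim_M (ln ` {t. t > exp 1 \<and> \<Gamma> t 0 0 \<omega> < 1 / (t * (ln t) powr \<delta>)})
                     (max (1 - 2 * \<delta> * \<nu> / \<rho> 0) 0)"
proof -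
  interpret brownian_motion M W
    by unfold_locales fact
  let ?\<kappa> = "2 * \<delta> * \<nu> / \<rho> 0" and ?c = "4 * \<nu> / \<rho> 0 * ln (4 * pi * \<nu>)"
  have "?\<kappa> > 0" using assms by simp
  from AE_has_Dim_M_exceedance[OF this, of ?c] assms(6) show ?thesis
  proof eventually_elim
    case (elim \<omega>)
    have iff: "\<Gamma> (exp s) 0 0 \<omega> < 1 / (exp s * s powr \<delta>) \<longleftrightarrow> s \<in> exceedance ?\<kappa> ?c \<omega>" if "s > 1" for s
      using heat_kernel_product_less_iff[OF \<open>\<nu> > 0\<close> \<open>\<rho> 0 > 0\<close> that, of "W (exp s) \<omega>" \<delta>] elim(2) that
      by (simp add: exceedance_def)
    \<comment> \<open>The logarithm maps the times above \<open>e\<close> bijectively onto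
      \<open>s > 1\<close>, with \<open>exp\<close> as inverse, so \<open>iff\<close> transfers
      membership both ways.\<close>
    have "ln ` {t. t > exp 1 \<and> \<Gamma> t 0 0 \<omega> < 1 / (t * (ln t) powr \<delta>)} = exceedance ?\<kappa> ?c \<omega>"
    proof (intro equalityI subsetI)
      fix s assume "s \<in> ln ` {t. t > exp 1 \<and> \<Gamma> t 0 0 \<omega> < 1 / (t * (ln t) powr \<delta>)}"
      then obtain t where t: "t > exp 1" "\<Gamma> t 0 0 \<omega> < 1 / (t * (ln t) powr \<delta>)" "s = ln t"
        by auto
      then have "t > 0" using exp_gt_zero[of "1 :: real"] by linarith
      then have "s > 1" "exp s = t" using t ln_less_cancel_iff[of "exp 1" t] by auto
      then show "s \<in> exceedance ?\<kappa> ?c \<omega>" using iff[of s] t by simp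
    next
      fix s assume s: "s \<in> exceedance ?\<kappa> ?c \<omega>"
      then have "s > 1" by (simp add: exceedance_def)
      with s show "s \<in> ln ` {t. t > exp 1 \<and> \<Gamma> t 0 0 \<omega> < 1 / (t * (ln t) powr \<delta>)}"
        by (intro image_eqI[of _ _ "exp s"]) (simp_all only: iff ln_exp mem_Collect_eq exp_less_cancel_iff simp_thms)
    qed
    with elim(1) show ?case by simp
  qed
qed

end
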